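(* Let $\mathcal{P}=(S,s_0,P,V,Y)$ be a parametric interval Markov chain, $\alpha\subseteq A$ a label, $p\in[0,1]$, ${\sim}\in\{\le,<,\ge,>\}$ with negation $\not\sim$ (e.g. $\not\le$ is $>$), and let $(X,D,C)$ be the CSP $\mathbf{C}_{\exists\bar r}(\mathcal{P},\alpha)$. Then (i) the CSP $(X,D,C\cup\{\pi_{s_0}\sim p\})$ is satisfiable iff there exists an MC $\mathcal{M}\models^{a}_{\mathtt{pI}}\mathcal{P}$ with $\mathbb{P}^{\mathcal{M}}(\Diamond\alpha)\sim p$; and (ii) the CSP $(X,D,C\cup\{\pi_{s_0}\not\sim p\})$ is unsatisfiable iff every MC $\mathcal{M}\models^{a}_{\mathtt{pI}}\mathcal{P}$ satisfies $\mathbb{P}^{\mathcal{M}}(\Diamond\alpha)\sim p$.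
   Context: Fix a set $A$ of atomic propositions. A Markov chain (MC) is $\mathcal{M}=(T,t_0,p,V^M)$ with $T$ finite, $t_0\in T$, $V^M:T\to2^A$, $p:T\to\mathsf{Dist}(T)$; $\mathbb{P}^{\mathcal{M}}(\Diamond\alpha)$ is the probability that a path from $t_0$ eventually visits a state $u$ with $V^M(u)=\alpha$. An IMC is $\mathcal{I}=(S,s_0,P,V^I)$ with $P(s,s')$ an interval $\subseteq[0,1]$ (possibly empty). $\mathcal{M}\models^{a}_{\mathtt{I}}\mathcal{I}$ (at-every-step) iff there is $\mathcal{R}\subseteq T\times S$ with $(t_0,s_0)\in\mathcal{R}$ such that for each $(t,s)\in\mathcal{R}$: $V^M(t)=V^I(s)$ and there is $\delta:T\to(S\to[0,1])$ with (a) $\delta(t')$ a distribution on $S$ whenever $p(t)(t')>0$, (b) $\sum_{t'}p(t)(t')\delta(t')(s')\in P(s,s')$ for all $s'$, (c) $\delta(t')(s')>0\Rightarrow(t',s')\in\mathcal{R}$. A pIMC is $\mathcal{P}=(S,s_0,P,V,Y)$ with $S$ finite, $s_0\in S$, $V:S\to2^A$, $Y$ a finite set of parameters, $P(s,s')=[f_1,f_2]$ with $f_1,f_2$ rational functions over $Y$ (absent transitions: $[0,0]$). For $v:Y\to[0,1]$, $v([f_1,f_2])=[v(f_1),v(f_2)]$ if $0\le v(f_1)\le v(f_2)\le1$, else $\emptyset$; $v(\mathcal{P})=(S,s_0,P_v,V)$ with $P_v(s,s')=v(P(s,s'))$. $\mathcal{M}\models^{a}_{\mathtt{pI}}\mathcal{P}$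 iff $\mathcal{M}\models^{a}_{\mathtt{I}}v(\mathcal{P})$ for some $v$. $\mathsf{Succ}(s)=\{s'\mid P(s,s')\notin\{\emptyset,[0,0]\}\}$, $\mathsf{Pred}(s)=\{s'\mid P(s',s)\notin\{\emptyset,[0,0]\}\}$. A CSP $(X,D,C)$ has variables, domains, constraints; satisfiable iff some assignment satisfies all constraints. $\mathbf{C}_{\exists\bar r}(\mathcal{P},\alpha)$ has: real $\eta_y\in[0,1]$ ($y\in Y$); real $\theta_s^{s'}\in[0,1]$ ($s\in S$, $s'\in\mathsf{Succ}(s)$); Booleans $\rho_s,\lambda_s$, integers $\omega_s,\alpha_s\in\{0,\dots,|S|\}$ and real $\pi_s\in[0,1]$ for each $s\in S$; and for each $s\in S$ the constraints: (1) $\rho_s$ if $s=s_0$; (2) $\rho_s\Leftrightarrow\sum_{s'\in\mathsf{Succ}(s)}\theta_s^{s'}=1$; (3) if $s\ne s_0$: $\neg\rho_s\Leftrightarrow\sum_{s'\in\mathsf{Pred}(s)\setminus\{s\}}\theta_{s'}^{s}=0$; (4) $\neg\rho_s\Leftrightarrow\sum_{s'\in\mathsf{Succ}(s)}\theta_s^{s'}=0$; (5) for each $s'\in\mathsf{Succ}(s)$ with $P(s,s')=[f_1,f_2]$: $\rho_s\Rightarrow f_1(\eta)\le\theta_s^{s'}\le f_2(\eta)$ ($f_i(\eta)$: parameters $y$ replaced by $\eta_y$); (6) $\omega_s=1$ if $s=s_0$; (7) $\omega_s\ne1$ if $s\ne s_0$; (8) $\rho_s\Leftrightarrow\omega_s\ne0$;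 (9) if $s\ne s_0$: $\omega_s>1\Rightarrow\bigvee_{s'\in\mathsf{Pred}(s)\setminus\{s\}}((\omega_s=\omega_{s'}+1)\wedge(\theta_{s'}^{s}>0))$; (10) if $s\ne s_0$: $\omega_s=0\Leftrightarrow\bigwedge_{s'\in\mathsf{Pred}(s)\setminus\{s\}}((\omega_{s'}=0)\vee(\theta_{s'}^{s}=0))$; (11) $\alpha_s=1$ if $V(s)=\alpha$; (12) $\alpha_s\ne1$ if $V(s)\ne\alpha$; (13) $\lambda_s\Leftrightarrow(\rho_s\wedge\alpha_s\ne0)$; (14) if $V(s)\ne\alpha$: $\alpha_s>1\Rightarrow\bigvee_{s'\in\mathsf{Succ}(s)\setminus\{s\}}((\alpha_s=\alpha_{s'}+1)\wedge(\theta_s^{s'}>0))$; (15) if $V(s)\ne\alpha$: $\alpha_s=0\Leftrightarrow\bigwedge_{s'\in\mathsf{Succ}(s)\setminus\{s\}}((\alpha_{s'}=0)\vee(\theta_s^{s'}=0))$; (16) $\neg\lambda_s\Rightarrow\pi_s=0$; (17) if $V(s)=\alpha$: $\lambda_s\Rightarrow\pi_s=1$; (18) if $V(s)\ne\alpha$: $\lambda_s\Rightarrow\pi_s=\sum_{s'\in\mathsf{Succ}(s)}\theta_s^{s'}\,\pi_{s'}$.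
   Formalization: The CSP also contains, for s and s' in Succ(s) with P(s,s')=[f1,f2], the constraint ρ_s ⇒ 0 ≤ f1(η) and f2(η) ≤ 1; as printed the claim fails, e.g. one state labelled α with self-loop interval [1,2]. Undefined endpoints make the interval empty and constraint (5) false. *)

theory Defs
  imports
    "HOL-Probability.Probability"
    "HOL-Library.Poly_Mapping"
    "HOL-Library.Infinite_Typeclass"
    "HOL-Computational_Algebra.Fraction_Field"
begin

subsection \<open>Rational functions over a set of parameters\<close>

text \<open>
  Polynomials are finitely supported maps from exponent vectors to real coefficients; their fraction
  field is available in the library once the variables carry some (immaterial) linear order.
\<close>

type_synonym 'y mpoly = "('y \<Rightarrow>\<^sub>0 nat) \<Rightarrow>\<^sub>0 real"

type_synonym 'y ratfun = "'y mpoly fract"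

definition monom_eval :: "('y \<Rightarrow> real) \<Rightarrow> ('y \<Rightarrow>\<^sub>0 nat) \<Rightarrow> real" where
  "monom_eval v m = (\<Prod>y\<in>Poly_Mapping.keys m. v y ^ Poly_Mapping.lookup m y)"

definition mpoly_eval :: "('y \<Rightarrow> real) \<Rightarrow> 'y mpoly \<Rightarrow> real" where
  "mpoly_eval v g = (\<Sum>m\<in>Poly_Mapping.keys g. Poly_Mapping.lookup g m * monom_eval v m)"

definition mpoly_vars :: "'y mpoly \<Rightarrow> 'y set" where
  "mpoly_vars g = (\<Union>m\<in>Poly_Mapping.keys g. Poly_Mapping.keys m)"

definition ratfun_over :: "'y set \<Rightarrow> 'y::linorder ratfun \<Rightarrow> bool" where
  "ratfun_over Y f \<longleftrightarrow>
    (\<exists>g h. h \<noteq> 0 \<and> f = Fract g h \<and> mpoly_vars g \<subseteq> Y \<and> mpoly_vars h \<subseteq> Y)"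

text \<open>A rational function has a value at \<open>v\<close> iff some representation has a denominator that does
  not vanish at \<open>v\<close>; the value does not depend on the representation (\<open>ratfun_eval_Fract\<close> below).\<close>

definition ratfun_defined :: "('y \<Rightarrow> real) \<Rightarrow> 'y::linorder ratfun \<Rightarrow> bool" where
  "ratfun_defined v f \<longleftrightarrow> (\<exists>g h. f = Fract g h \<and> mpoly_eval v h \<noteq> 0)"

definition ratfun_eval :: "('y \<Rightarrow> real) \<Rightarrow> 'y::linorder ratfun \<Rightarrow> real" where
  "ratfun_eval v f =
    (THE r. \<exists>g h. f = Fract g h \<and> mpoly_eval v h \<noteq> 0 \<and> r = mpoly_eval v g / mpoly_eval v h)"

lemma monom_eval_superset:
  assumes "finite K" "Poly_Mapping.keys m \<subseteq> K"
  shows "monom_eval v m = (\<Prod>y\<in>K. v y ^ Poly_Mapping.lookup m y)"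
  unfolding monom_eval_def using assms
  by (intro prod.mono_neutral_left) (auto simp: in_keys_iff)

lemma monom_eval_add: "monom_eval v (m + n) = monom_eval v m * monom_eval v n"
proof -
  let ?K = "Poly_Mapping.keys m \<union> Poly_Mapping.keys n"
  have "Poly_Mapping.keys (m + n) \<subseteq> ?K" by (rule keys_add)
  then show ?thesis
    by (simp add: monom_eval_superset[of ?K] lookup_add power_add prod.distrib)
qed

lemma mpoly_eval_superset:
  assumes "finite K" "Poly_Mapping.keys g \<subseteq> K"
  shows "mpoly_eval v g = (\<Sum>m\<in>K. Poly_Mapping.lookup g m * monom_eval v m)"
  unfolding mpoly_eval_def using assms
  by (intro sum.mono_neutral_left) (auto simp: in_keys_iff)

lemma mpoly_eval_zero [simp]: "mpoly_eval v 0 = 0"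
  by (simp add: mpoly_eval_def)

lemma mpoly_eval_add: "mpoly_eval v (g + h) = mpoly_eval v g + mpoly_eval v h"
proof -
  let ?K = "Poly_Mapping.keys g \<union> Poly_Mapping.keys h"
  have "Poly_Mapping.keys (g + h) \<subseteq> ?K" by (rule keys_add)
  then show ?thesis
    by (simp add: mpoly_eval_superset[of ?K] lookup_add algebra_simps sum.distrib)
qed

lemma mpoly_eval_single: "mpoly_eval v (Poly_Mapping.single m c) = c * monom_eval v m"
  by (simp add: mpoly_eval_def)

lemma mpoly_eval_sum: "mpoly_eval v (\<Sum>i\<in>I. g i) = (\<Sum>i\<in>I. mpoly_eval v (g i))"
  by (induction I rule: infinite_finite_induct) (simp_all add: mpoly_eval_add)

lemma mpoly_sum_single:
  "(g :: 'y mpoly) = (\<Sum>m\<in>Poly_Mapping.keys g. Poly_Mapping.single m (Poly_Mapping.lookup g m))"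
  by (rule poly_mapping_eqI)
    (auto simp: lookup_sum lookup_single when_def in_keys_iff sum.delta)

lemma mpoly_eval_mult:
  fixes g h :: "'y mpoly"
  shows "mpoly_eval v (g * h) = mpoly_eval v g * mpoly_eval v h"
proof -
  have "g * h = (\<Sum>m\<in>Poly_Mapping.keys g. \<Sum>n\<in>Poly_Mapping.keys h.
      Poly_Mapping.single (m + n) (Poly_Mapping.lookup g m * Poly_Mapping.lookup h n))"
    by (subst mpoly_sum_single[of g], subst mpoly_sum_single[of h])
      (simp add: sum_product mult_single)
  then show ?thesis
    by (simp add: mpoly_eval_sum mpoly_eval_single monom_eval_add)
      (simp add: mpoly_eval_def sum_product algebra_simps)
qed

lemma ratfun_eval_Fract:
  fixes g h :: "'y::linorder mpoly"
  assumes "mpoly_eval v h \<noteq> 0"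
  shows "ratfun_eval v (Fract g h) = mpoly_eval v g / mpoly_eval v h"
  unfolding ratfun_eval_def
proof (rule the_equality)
  show "\<exists>g' h'. Fract g h = Fract g' h' \<and> mpoly_eval v h' \<noteq> 0 \<and>
      mpoly_eval v g / mpoly_eval v h = mpoly_eval v g' / mpoly_eval v h'"
    using assms by blast
next
  fix r
  assume "\<exists>g' h'. Fract g h = Fract g' h' \<and> mpoly_eval v h' \<noteq> 0 \<and>
      r = mpoly_eval v g' / mpoly_eval v h'"
  then obtain g' h' where *: "Fract g h = Fract g' h'" "mpoly_eval v h' \<noteq> 0"
    "r = mpoly_eval v g' / mpoly_eval v h'" by blast
  have "h \<noteq> 0" "h' \<noteq> 0" using assms *(2) by auto
  then have "g * h' = g' * h" using *(1) by (simp add: eq_fract)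
  then have "mpoly_eval v g * mpoly_eval v h' = mpoly_eval v g' * mpoly_eval v h"
    by (simp flip: mpoly_eval_mult)
  then show "r = mpoly_eval v g / mpoly_eval v h"
    using assms *(2,3) by (simp add: frac_eq_eq)
qed


subsection \<open>Markov chains\<close>

record ('t, 'a) mc =
  mc_states :: "'t set"
  mc_init :: 't
  mc_trans :: "'t \<Rightarrow> 't pmf"
  mc_label :: "'t \<Rightarrow> 'a set"

definition is_mc :: "'a set \<Rightarrow> ('t, 'a) mc \<Rightarrow> bool" where
  "is_mc A M \<longleftrightarrow> finite (mc_states M) \<and> mc_init M \<in> mc_states M \<and>
    (\<forall>t\<in>mc_states M. set_pmf (mc_trans M t) \<subseteq> mc_states M \<and> mc_label M t \<subseteq> A)"

text \<open>The distribution of the state at time \<open>n\<close> given the states at the earlier times.\<close>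

definition mc_kernel :: "('t, 'a) mc \<Rightarrow> nat \<Rightarrow> (nat \<Rightarrow> 't) \<Rightarrow> 't measure" where
  "mc_kernel M n \<omega> =
    measure_pmf (case n of 0 \<Rightarrow> return_pmf (mc_init M) | Suc k \<Rightarrow> mc_trans M (\<omega> k))"

text \<open>The measure on infinite paths obtained from the kernels by the Ionescu-Tulcea theorem
  (its values on cylinders are computed in \<open>emeasure_path_measure_cylinder\<close> below).\<close>

definition path_measure :: "('t, 'a) mc \<Rightarrow> (nat \<Rightarrow> 't) measure" where
  "path_measure M = projective_family.lim UNIV
    (Ionescu_Tulcea.CI (mc_kernel M) (\<lambda>_. count_space UNIV)) (\<lambda>_. count_space UNIV)"

definition reach_prob :: "('t, 'a) mc \<Rightarrow> 'a set \<Rightarrow> real" where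
  "reach_prob M \<alpha> =
    measure (path_measure M) {\<omega> \<in> space (path_measure M). \<exists>n. mc_label M (\<omega> n) = \<alpha>}"

lemma Ionescu_Tulcea_mc: "Ionescu_Tulcea (mc_kernel M) (\<lambda>_. count_space UNIV)"
proof (rule Ionescu_Tulcea.intro)
  show "mc_kernel M i \<in> measurable (PiM {0..<i} (\<lambda>_. count_space UNIV))
      (subprob_algebra (count_space UNIV))" for i
  proof (cases i)
    case 0
    then show ?thesis
      by (simp add: mc_kernel_def[abs_def])
  next
    case (Suc k)
    have *: "(\<lambda>t. measure_pmf (mc_trans M t)) \<in>
        measurable (count_space UNIV) (subprob_algebra (count_space UNIV))"
      by (simp add: space_subprob_algebra subprob_space_measure_pmf)
    have "(\<lambda>\<omega>. measure_pmf (mc_trans M (\<omega> k))) \<in>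
        measurable (PiM {0..<i} (\<lambda>_. count_space UNIV)) (subprob_algebra (count_space UNIV))"
      by (rule measurable_compose[OF _ *], rule measurable_component_singleton) (simp add: Suc)
    then show ?thesis
      by (simp add: mc_kernel_def[abs_def] Suc)
  qed
  show "prob_space (mc_kernel M i x)"
    if "x \<in> space (PiM {0..<i} (\<lambda>_. count_space UNIV))" for i x
    by (simp add: mc_kernel_def prob_space_measure_pmf)
qed

lemma emeasure_path_measure_cylinder:
  "emeasure (path_measure M) {\<omega>. \<forall>i\<le>n. \<omega> i = x i} =
    (if x 0 = mc_init M then \<Prod>i<n. ennreal (pmf (mc_trans M (x i)) (x (Suc i))) else 0)"
proof -
  interpret IT: Ionescu_Tulcea "mc_kernel M" "\<lambda>_. count_space UNIV"
    by (rule Ionescu_Tulcea_mc)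
  define X where "X n = PiE {0..<n} (\<lambda>i. {x i})" for n
  have X_sets [measurable]: "X n \<in> sets (PiM {0..<n} (\<lambda>_. count_space UNIV))" for n
    unfolding X_def by (rule sets_PiM_I_finite) auto
  have X_mem: "\<omega> \<in> X n \<longleftrightarrow> \<omega> = restrict x {0..<n}" for \<omega> n
    by (auto simp: X_def PiE_iff fun_eq_iff extensional_def)
  have C: "emeasure (IT.C 0 n (\<lambda>_. undefined)) (X n) = (\<Prod>i<n. emeasure (mc_kernel M i x) {x i})" for n
  proof (induction n)
    case 0
    have "(\<lambda>_. undefined) \<in> X 0" by (simp add: X_def)
    then show ?case using X_sets[of 0] by (simp add: PiM_empty)
  next
    case (Suc n)
    let ?C = "IT.C 0 n (\<lambda>_. undefined)"
    have u: "(\<lambda>_. undefined) \<in> space (PiM {0..<0::nat} (\<lambda>_. count_space UNIV))"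
      by (simp add: space_PiM)
    have "emeasure (IT.C 0 (Suc n) (\<lambda>_. undefined)) (X (Suc n)) =
        (\<integral>\<^sup>+\<omega>. emeasure (IT.eP n \<omega>) (X (Suc n)) \<partial>?C)"
      unfolding IT.C.simps add_0
    proof (rule emeasure_bind[OF _ _ X_sets])
      show "space ?C \<noteq> {}"
        by (rule prob_space.not_empty[OF IT.prob_space_C[OF u]])
      show "IT.eP n \<in> measurable ?C (subprob_algebra (PiM {0..<Suc n} (\<lambda>_. count_space UNIV)))"
        using IT.measurable_eP[of n] IT.sets_C[OF u, of n]
        by (simp cong: measurable_cong_sets)
    qed
    also have "\<dots> = (\<integral>\<^sup>+\<omega>. emeasure (mc_kernel M n x) {x n} * indicator (X n) \<omega> \<partial>?C)"
    proof (rule nn_integral_cong)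
      fix \<omega> assume "\<omega> \<in> space ?C"
      then have \<omega>: "\<omega> \<in> space (PiM {0..<n} (\<lambda>_. count_space UNIV))"
        using IT.space_C[OF u, of n] by simp
      then have ext: "\<omega> \<in> extensional {0..<n}"
        by (simp add: space_PiM PiE_iff)
      have eq: "fun_upd \<omega> n y \<in> X (Suc n) \<longleftrightarrow> \<omega> \<in> X n \<and> y = x n" for y
      proof
        assume "fun_upd \<omega> n y \<in> X (Suc n)"
        then have a: "(fun_upd \<omega> n y) i = x i" if "i < Suc n" for i
          using that by (auto simp: X_def PiE_iff)
        have "\<omega> i = x i" if "i < n" for i using a[of i] that by auto
        moreover have "y = x n" using a[of n] by simp
        ultimately show "\<omega> \<in> X n \<and> y = x n" using ext by (auto simp: X_def PiE_iff)
      next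
        assume "\<omega> \<in> X n \<and> y = x n"
        then show "fun_upd \<omega> n y \<in> X (Suc n)"
          by (auto simp: X_def PiE_iff extensional_def less_Suc_eq)
      qed
      have "emeasure (IT.eP n \<omega>) (X (Suc n)) = emeasure (mc_kernel M n \<omega>) {y. \<omega> \<in> X n \<and> y = x n}"
        by (subst IT.emeasure_eP[OF \<omega> X_sets]) (simp add: vimage_def eq)
      also have "\<dots> = emeasure (mc_kernel M n x) {x n} * indicator (X n) \<omega>"
        by (cases n) (auto simp: mc_kernel_def X_mem split: split_indicator)
      finally show "emeasure (IT.eP n \<omega>) (X (Suc n)) =
          emeasure (mc_kernel M n x) {x n} * indicator (X n) \<omega>" .
    qed
    also have "\<dots> = emeasure (mc_kernel M n x) {x n} * emeasure ?C (X n)"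
      using X_sets[of n] IT.sets_C[OF u, of n] by (subst nn_integral_cmult_indicator) auto
    finally show ?case using Suc by (simp add: mult.commute)
  qed
  have "{\<omega>. \<forall>i\<le>n. \<omega> i = x i} = IT.PF.emb UNIV {0..<Suc n} (X (Suc n))"
    by (auto simp: prod_emb_def space_PiM X_def PiE_iff less_Suc_eq_le)
  then have "emeasure (path_measure M) {\<omega>. \<forall>i\<le>n. \<omega> i = x i} = emeasure (IT.CI {0..<Suc n}) (X (Suc n))"
    using IT.lim[of "{0..<Suc n}" "X (Suc n)"] X_sets[of "Suc n"] by (simp add: path_measure_def)
  also have "\<dots> = emeasure (IT.C 0 (Suc n) (\<lambda>_. undefined)) (X (Suc n))"
    using IT.emeasure_CI[of "{0..<Suc n}" "Suc n" "X (Suc n)"] X_sets[of "Suc n"]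
    by (simp add: prod_emb_id X_def del: IT.C.simps)
  also have "\<dots> = (\<Prod>i<Suc n. emeasure (mc_kernel M i x) {x i})"
    by (rule C)
  also have "\<dots> = (if x 0 = mc_init M then \<Prod>i<n. ennreal (pmf (mc_trans M (x i)) (x (Suc i))) else 0)"
    by (simp add: prod.lessThan_Suc_shift mc_kernel_def emeasure_pmf_single pmf_return indicator_def
      del: prod.lessThan_Suc)
  finally show ?thesis .
qed


subsection \<open>Interval Markov chains\<close>

record ('s, 'a) imc =
  imc_states :: "'s set"
  imc_init :: 's
  imc_trans :: "'s \<Rightarrow> 's \<Rightarrow> real set"
  imc_label :: "'s \<Rightarrow> 'a set"

definition sat_imc_at_every_step :: "('t, 'a) mc \<Rightarrow> ('s, 'a) imc \<Rightarrow> bool" where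
  "sat_imc_at_every_step M I \<longleftrightarrow>
    (\<exists>R \<subseteq> mc_states M \<times> imc_states I. (mc_init M, imc_init I) \<in> R \<and>
      (\<forall>(t, s) \<in> R. mc_label M t = imc_label I s \<and>
        (\<exists>\<delta> :: 't \<Rightarrow> 's \<Rightarrow> real.
          (\<forall>t'\<in>mc_states M. \<forall>s'\<in>imc_states I. \<delta> t' s' \<in> {0..1}) \<and>
          (\<forall>t'\<in>mc_states M. pmf (mc_trans M t) t' > 0 \<longrightarrow> (\<Sum>s'\<in>imc_states I. \<delta> t' s') = 1) \<and>
          (\<forall>s'\<in>imc_states I.
            (\<Sum>t'\<in>mc_states M. pmf (mc_trans M t) t' * \<delta> t' s') \<in> imc_trans I s s') \<and>
          (\<forall>t'\<in>mc_states M. \<forall>s'\<in>imc_states I. \<delta> t' s' > 0 \<longrightarrow> (t', s') \<in> R))))"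


subsection \<open>Parametric interval Markov chains\<close>

text \<open>A parametric interval is given by its two endpoints; absent transitions carry \<open>(0, 0)\<close>.\<close>

record ('s, 'a, 'y) pimc =
  pimc_states :: "'s set"
  pimc_init :: 's
  pimc_trans :: "'s \<Rightarrow> 's \<Rightarrow> 'y ratfun \<times> 'y ratfun"
  pimc_label :: "'s \<Rightarrow> 'a set"
  pimc_params :: "'y set"

definition is_pimc :: "'a set \<Rightarrow> ('s, 'a, 'y::linorder) pimc \<Rightarrow> bool" where
  "is_pimc A P \<longleftrightarrow>
    finite (pimc_states P) \<and> pimc_init P \<in> pimc_states P \<and> finite (pimc_params P) \<and>
    (\<forall>s\<in>pimc_states P. pimc_label P s \<subseteq> A) \<and>
    (\<forall>s\<in>pimc_states P. \<forall>s'\<in>pimc_states P.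
      ratfun_over (pimc_params P) (fst (pimc_trans P s s')) \<and>
      ratfun_over (pimc_params P) (snd (pimc_trans P s s')))"

text \<open>An endpoint without a value at \<open>v\<close> makes the interval empty, as an endpoint outside
  \<open>[0,1]\<close> does.\<close>

definition interval_at :: "('y \<Rightarrow> real) \<Rightarrow> 'y::linorder ratfun \<times> 'y ratfun \<Rightarrow> real set" where
  "interval_at v = (\<lambda>(f\<^sub>1, f\<^sub>2).
    if ratfun_defined v f\<^sub>1 \<and> ratfun_defined v f\<^sub>2 \<and>
       0 \<le> ratfun_eval v f\<^sub>1 \<and> ratfun_eval v f\<^sub>1 \<le> ratfun_eval v f\<^sub>2 \<and> ratfun_eval v f\<^sub>2 \<le> 1
    then {ratfun_eval v f\<^sub>1..ratfun_eval v f\<^sub>2} else {})"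

definition pimc_at :: "('y \<Rightarrow> real) \<Rightarrow> ('s, 'a, 'y::linorder) pimc \<Rightarrow> ('s, 'a) imc" where
  "pimc_at v P =
    \<lparr>imc_states = pimc_states P, imc_init = pimc_init P,
     imc_trans = (\<lambda>s s'. interval_at v (pimc_trans P s s')), imc_label = pimc_label P\<rparr>"

definition sat_pimc_at_every_step :: "('t, 'a) mc \<Rightarrow> ('s, 'a, 'y::linorder) pimc \<Rightarrow> bool" where
  "sat_pimc_at_every_step M P \<longleftrightarrow>
    (\<exists>v. (\<forall>y\<in>pimc_params P. v y \<in> {0..1}) \<and> sat_imc_at_every_step M (pimc_at v P))"

definition Succ :: "('s, 'a, 'y::linorder) pimc \<Rightarrow> 's \<Rightarrow> 's set" where
  "Succ P s = {s' \<in> pimc_states P. pimc_trans P s s' \<noteq> (0, 0)}"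

definition Pred :: "('s, 'a, 'y::linorder) pimc \<Rightarrow> 's \<Rightarrow> 's set" where
  "Pred P s = {s' \<in> pimc_states P. pimc_trans P s' s \<noteq> (0, 0)}"


subsection \<open>Constraint satisfaction problems\<close>

record ('x, 'd) csp =
  csp_vars :: "'x set"
  csp_dom :: "'x \<Rightarrow> 'd set"
  csp_constraints :: "(('x \<Rightarrow> 'd) \<Rightarrow> bool) set"

definition csp_satisfiable :: "('x, 'd) csp \<Rightarrow> bool" where
  "csp_satisfiable Q \<longleftrightarrow>
    (\<exists>\<sigma>. (\<forall>x\<in>csp_vars Q. \<sigma> x \<in> csp_dom Q x) \<and> (\<forall>c\<in>csp_constraints Q. c \<sigma>))"

definition csp_add :: "('x, 'd) csp \<Rightarrow> (('x \<Rightarrow> 'd) \<Rightarrow> bool) set \<Rightarrow> ('x, 'd) csp" where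
  "csp_add Q C' = Q\<lparr>csp_constraints := csp_constraints Q \<union> C'\<rparr>"

datatype csp_val = Real_val (the_real: real) | Bool_val (the_bool: bool) | Int_val (the_int: int)

datatype ('s, 'y) csp_var =
    Eta_var 'y | Theta_var 's 's | Rho_var 's | Lambda_var 's | Omega_var 's | Alpha_var 's | Pi_var 's

type_synonym ('s, 'y) assignment = "('s, 'y) csp_var \<Rightarrow> csp_val"

definition eta :: "('s, 'y) assignment \<Rightarrow> 'y \<Rightarrow> real" where
  "eta \<sigma> y = the_real (\<sigma> (Eta_var y))"

text \<open>\<open>theta \<sigma> s s'\<close> is the variable for the transition from \<open>s\<close> to \<open>s'\<close>.\<close>

definition theta :: "('s, 'y) assignment \<Rightarrow> 's \<Rightarrow> 's \<Rightarrow> real" where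
  "theta \<sigma> s s' = the_real (\<sigma> (Theta_var s s'))"

definition rho :: "('s, 'y) assignment \<Rightarrow> 's \<Rightarrow> bool" where
  "rho \<sigma> s = the_bool (\<sigma> (Rho_var s))"

definition lam :: "('s, 'y) assignment \<Rightarrow> 's \<Rightarrow> bool" where
  "lam \<sigma> s = the_bool (\<sigma> (Lambda_var s))"

definition omega :: "('s, 'y) assignment \<Rightarrow> 's \<Rightarrow> int" where
  "omega \<sigma> s = the_int (\<sigma> (Omega_var s))"

definition alph :: "('s, 'y) assignment \<Rightarrow> 's \<Rightarrow> int" where
  "alph \<sigma> s = the_int (\<sigma> (Alpha_var s))"

definition pr :: "('s, 'y) assignment \<Rightarrow> 's \<Rightarrow> real" where
  "pr \<sigma> s = the_real (\<sigma> (Pi_var s))"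

fun reach_csp_dom :: "('s, 'a, 'y) pimc \<Rightarrow> ('s, 'y) csp_var \<Rightarrow> csp_val set" where
  "reach_csp_dom P (Eta_var y) = Real_val ` {0..1}"
| "reach_csp_dom P (Theta_var s s') = Real_val ` {0..1}"
| "reach_csp_dom P (Rho_var s) = range Bool_val"
| "reach_csp_dom P (Lambda_var s) = range Bool_val"
| "reach_csp_dom P (Omega_var s) = Int_val ` {0..int (card (pimc_states P))}"
| "reach_csp_dom P (Alpha_var s) = Int_val ` {0..int (card (pimc_states P))}"
| "reach_csp_dom P (Pi_var s) = Real_val ` {0..1}"

definition reach_csp_vars :: "('s, 'a, 'y::linorder) pimc \<Rightarrow> ('s, 'y) csp_var set" where
  "reach_csp_vars P =
    Eta_var ` pimc_params P \<union>
    (\<Union>s\<in>pimc_states P. Theta_var s ` Succ P s) \<union>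
    (\<Union>s\<in>pimc_states P. {Rho_var s, Lambda_var s, Omega_var s, Alpha_var s, Pi_var s})"

text \<open>
  \<open>\<rho>\<^sub>s\<close> selects the states of the induced chain and \<open>\<theta>\<close> gives their outgoing distributions.

  The last constraint expresses the convention of \<^const>\<open>interval_at\<close> that an instantiated
  interval not contained in \<open>[0,1]\<close> is empty. It holds trivially if the endpoints always have values
  in \<open>[0,1]\<close>, but cannot be dropped in general: for the constant interval \<open>[1,2]\<close> on the self-loop of
  a single state, \<open>1 \<le> \<theta> \<le> 2\<close> has the solution \<open>\<theta> = 1\<close> although no Markov chain satisfies the model.
\<close>

definition structure_constraints ::
    "('s, 'a, 'y::linorder) pimc \<Rightarrow> 's \<Rightarrow> (('s, 'y) assignment \<Rightarrow> bool) set" where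
  "structure_constraints P s =
    {\<lambda>\<sigma>. s = pimc_init P \<longrightarrow> rho \<sigma> s,
     \<lambda>\<sigma>. rho \<sigma> s \<longleftrightarrow> (\<Sum>s'\<in>Succ P s. theta \<sigma> s s') = 1,
     \<lambda>\<sigma>. s \<noteq> pimc_init P \<longrightarrow> (\<not> rho \<sigma> s \<longleftrightarrow> (\<Sum>s'\<in>Pred P s - {s}. theta \<sigma> s' s) = 0),
     \<lambda>\<sigma>. \<not> rho \<sigma> s \<longleftrightarrow> (\<Sum>s'\<in>Succ P s. theta \<sigma> s s') = 0} \<union>
    (\<Union>s'\<in>Succ P s.
      {\<lambda>\<sigma>. rho \<sigma> s \<longrightarrow> (case pimc_trans P s s' of (f\<^sub>1, f\<^sub>2) \<Rightarrow>
         ratfun_defined (eta \<sigma>) f\<^sub>1 \<and> ratfun_defined (eta \<sigma>) f\<^sub>2 \<and>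
         ratfun_eval (eta \<sigma>) f\<^sub>1 \<le> theta \<sigma> s s' \<and> theta \<sigma> s s' \<le> ratfun_eval (eta \<sigma>) f\<^sub>2),
       \<lambda>\<sigma>. rho \<sigma> s \<longrightarrow> (case pimc_trans P s s' of (f\<^sub>1, f\<^sub>2) \<Rightarrow>
         0 \<le> ratfun_eval (eta \<sigma>) f\<^sub>1 \<and> ratfun_eval (eta \<sigma>) f\<^sub>2 \<le> 1)})"

text \<open>\<open>\<omega>\<^sub>s\<close> certifies that \<open>s\<close> is reachable from the initial state.\<close>

definition from_init_constraints ::
    "('s, 'a, 'y::linorder) pimc \<Rightarrow> 's \<Rightarrow> (('s, 'y) assignment \<Rightarrow> bool) set" where
  "from_init_constraints P s =
    {\<lambda>\<sigma>. s = pimc_init P \<longrightarrow> omega \<sigma> s = 1,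
     \<lambda>\<sigma>. s \<noteq> pimc_init P \<longrightarrow> omega \<sigma> s \<noteq> 1,
     \<lambda>\<sigma>. rho \<sigma> s \<longleftrightarrow> omega \<sigma> s \<noteq> 0,
     \<lambda>\<sigma>. s \<noteq> pimc_init P \<longrightarrow> omega \<sigma> s > 1 \<longrightarrow>
       (\<exists>s'\<in>Pred P s - {s}. omega \<sigma> s = omega \<sigma> s' + 1 \<and> theta \<sigma> s' s > 0),
     \<lambda>\<sigma>. s \<noteq> pimc_init P \<longrightarrow>
       (omega \<sigma> s = 0 \<longleftrightarrow> (\<forall>s'\<in>Pred P s - {s}. omega \<sigma> s' = 0 \<or> theta \<sigma> s' s = 0))}"

text \<open>\<open>\<alpha>\<^sub>s\<close> certifies that a state labelled \<open>\<alpha>\<close> is reachable from \<open>s\<close>.\<close>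

definition to_label_constraints ::
    "('s, 'a, 'y::linorder) pimc \<Rightarrow> 'a set \<Rightarrow> 's \<Rightarrow> (('s, 'y) assignment \<Rightarrow> bool) set" where
  "to_label_constraints P \<alpha> s =
    {\<lambda>\<sigma>. pimc_label P s = \<alpha> \<longrightarrow> alph \<sigma> s = 1,
     \<lambda>\<sigma>. pimc_label P s \<noteq> \<alpha> \<longrightarrow> alph \<sigma> s \<noteq> 1,
     \<lambda>\<sigma>. lam \<sigma> s \<longleftrightarrow> rho \<sigma> s \<and> alph \<sigma> s \<noteq> 0,
     \<lambda>\<sigma>. pimc_label P s \<noteq> \<alpha> \<longrightarrow> alph \<sigma> s > 1 \<longrightarrow>
       (\<exists>s'\<in>Succ P s - {s}. alph \<sigma> s = alph \<sigma> s' + 1 \<and> theta \<sigma> s s' > 0),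
     \<lambda>\<sigma>. pimc_label P s \<noteq> \<alpha> \<longrightarrow>
       (alph \<sigma> s = 0 \<longleftrightarrow> (\<forall>s'\<in>Succ P s - {s}. alph \<sigma> s' = 0 \<or> theta \<sigma> s s' = 0))}"

text \<open>\<open>\<pi>\<^sub>s\<close> is the probability of reaching a state labelled \<open>\<alpha>\<close> from \<open>s\<close>.\<close>

definition probability_constraints ::
    "('s, 'a, 'y::linorder) pimc \<Rightarrow> 'a set \<Rightarrow> 's \<Rightarrow> (('s, 'y) assignment \<Rightarrow> bool) set" where
  "probability_constraints P \<alpha> s =
    {\<lambda>\<sigma>. \<not> lam \<sigma> s \<longrightarrow> pr \<sigma> s = 0,
     \<lambda>\<sigma>. pimc_label P s = \<alpha> \<longrightarrow> lam \<sigma> s \<longrightarrow> pr \<sigma> s = 1,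
     \<lambda>\<sigma>. pimc_label P s \<noteq> \<alpha> \<longrightarrow> lam \<sigma> s \<longrightarrow>
       pr \<sigma> s = (\<Sum>s'\<in>Succ P s. theta \<sigma> s s' * pr \<sigma> s')}"

definition reach_csp ::
    "('s, 'a, 'y::linorder) pimc \<Rightarrow> 'a set \<Rightarrow> (('s, 'y) csp_var, csp_val) csp" where
  "reach_csp P \<alpha> =
    \<lparr>csp_vars = reach_csp_vars P,
     csp_dom = reach_csp_dom P,
     csp_constraints = (\<Union>s\<in>pimc_states P.
       structure_constraints P s \<union> from_init_constraints P s \<union>
       to_label_constraints P \<alpha> s \<union> probability_constraints P \<alpha> s)\<rparr>"

end

theory Submission
  imports Defs
begin

text \<open>
  A solution of the CSP is a Markov chain on states of the model together with a solution \<open>\<pi>\<close> of its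
  hitting equations; the counters \<open>\<omega>\<close> and \<open>\<alpha>\<close> remove unreachable states and spurious solutions, so \<open>\<pi>\<close>
  is the reachability probability of that chain. Conversely, a chain \<open>M\<close> with satisfaction relation
  \<open>R\<close> may treat a state \<open>s\<close> of the model differently at its different \<open>R\<close>-partners \<open>t\<close>. Fixing for
  each \<open>s\<close> one partner and always taking its transition probabilities gives a chain on the model. If
  the partner has minimal reachability probability among all partners, these minima satisfy the
  hitting equations as inequalities \<open>\<ge>\<close>, so the new chain does not reach the label with larger
  probability than \<open>M\<close>; choosing maximal partners gives the dual bound. One of the two chains
  satisfies the threshold whenever \<open>M\<close> does. Part (ii) is part (i) for the negated comparison.
\<close>

subsection \<open>Hitting probabilities of finite chains\<close>

text \<open>A real matrix in place of a family of \<open>pmf\<close>s, so that the numbers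
  \<open>theta\<close> of a CSP solution form a chain directly. Entries of \<open>K\<close> outside
  \<open>S\<close> are unconstrained.\<close>

definition stochastic_on :: "'s set \<Rightarrow> ('s \<Rightarrow> 's \<Rightarrow> real) \<Rightarrow> bool" where
  "stochastic_on S K \<longleftrightarrow> finite S \<and> (\<forall>s\<in>S. (\<forall>s'\<in>S. 0 \<le> K s s') \<and> (\<Sum>s'\<in>S. K s s') = 1)"

text \<open>First-step recursion for the probability of visiting \<open>G\<close> within
  \<open>n\<close> steps.\<close>

fun hit :: "'s set \<Rightarrow> ('s \<Rightarrow> 's \<Rightarrow> real) \<Rightarrow> 's set \<Rightarrow> nat \<Rightarrow> 's \<Rightarrow> real" where
  "hit S K G 0 s = (if s \<in> G then 1 else 0)"
| "hit S K G (Suc n) s = (if s \<in> G then 1 else \<Sum>s'\<in>S. K s s' * hit S K G n s')"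

definition hit_prob :: "'s set \<Rightarrow> ('s \<Rightarrow> 's \<Rightarrow> real) \<Rightarrow> 's set \<Rightarrow> 's \<Rightarrow> real" where
  "hit_prob S K G s = lim (\<lambda>n. hit S K G n s)"

lemma stochastic_onD:
  assumes "stochastic_on S K"
  shows "finite S" and "s \<in> S \<Longrightarrow> s' \<in> S \<Longrightarrow> 0 \<le> K s s'" and "s \<in> S \<Longrightarrow> (\<Sum>s'\<in>S. K s s') = 1"
  using assms by (auto simp: stochastic_on_def)

lemma hit_bounds:
  assumes "stochastic_on S K" "s \<in> S"
  shows "0 \<le> hit S K G n s \<and> hit S K G n s \<le> 1"
  using assms(2)
proof (induction n arbitrary: s)
  case (Suc n)
  have "(\<Sum>s'\<in>S. K s s' * hit S K G n s') \<le> (\<Sum>s'\<in>S. K s s' * 1)"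
    using Suc stochastic_onD[OF assms(1)] by (intro sum_mono mult_left_mono) auto
  then show ?case
    using Suc stochastic_onD[OF assms(1)] by (auto intro!: sum_nonneg)
qed auto

lemma hit_mono_Suc:
  assumes "stochastic_on S K" "s \<in> S"
  shows "hit S K G n s \<le> hit S K G (Suc n) s"
  using assms(2)
proof (induction n arbitrary: s)
  case 0
  then show ?case
    using stochastic_onD[OF assms(1)] by (auto intro!: sum_nonneg)
next
  case (Suc n)
  show ?case
  proof (cases "s \<in> G")
    case False
    have "(\<Sum>s'\<in>S. K s s' * hit S K G n s') \<le> (\<Sum>s'\<in>S. K s s' * hit S K G (Suc n) s')"
      using Suc stochastic_onD[OF assms(1)] by (intro sum_mono mult_left_mono) auto
    with False show ?thesis by simp
  qed simp
qed

text \<open>The approximations increase with \<open>n\<close> and are bounded by 1, so the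
  \<open>lim\<close> in \<open>hit_prob\<close> is a genuine limit.\<close>

lemma hit_LIMSEQ:
  assumes "stochastic_on S K" "s \<in> S"
  shows "(\<lambda>n. hit S K G n s) \<longlonglongrightarrow> hit_prob S K G s"
proof -
  have "incseq (\<lambda>n. hit S K G n s)"
    using hit_mono_Suc[OF assms] by (intro incseq_SucI) auto
  moreover have "Bseq (\<lambda>n. hit S K G n s)"
    using hit_bounds[OF assms] by (intro BseqI'[where K = 1]) auto
  ultimately have "convergent (\<lambda>n. hit S K G n s)"
    by (intro Bseq_monoseq_convergent incseq_imp_monoseq)
  then show ?thesis
    by (simp add: convergent_LIMSEQ_iff hit_prob_def)
qed

lemma hit_prob_bounds:
  assumes "stochastic_on S K" "s \<in> S"
  shows "hit_prob S K G s \<in> {0..1}"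
  using hit_bounds[OF assms, of G] LIMSEQ_le_const[OF hit_LIMSEQ[OF assms], of 0 G]
    LIMSEQ_le_const2[OF hit_LIMSEQ[OF assms], of G 1]
  by simp

lemma hit_prob_target:
  assumes "stochastic_on S K" "s \<in> S" "s \<in> G"
  shows "hit_prob S K G s = 1"
proof -
  have "hit S K G n s = 1" for n using assms(3) by (cases n) auto
  then show ?thesis using hit_LIMSEQ[OF assms(1,2), of G] by (simp add: LIMSEQ_const_iff)
qed

lemma hit_prob_step:
  assumes "stochastic_on S K" "s \<in> S" "s \<notin> G"
  shows "hit_prob S K G s = (\<Sum>s'\<in>S. K s s' * hit_prob S K G s')"
proof (rule LIMSEQ_unique)
  show "(\<lambda>n. hit S K G (Suc n) s) \<longlonglongrightarrow> hit_prob S K G s"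
    by (rule LIMSEQ_Suc[OF hit_LIMSEQ[OF assms(1,2)]])
  show "(\<lambda>n. hit S K G (Suc n) s) \<longlonglongrightarrow> (\<Sum>s'\<in>S. K s s' * hit_prob S K G s')"
    using assms(3) by (auto intro!: tendsto_sum tendsto_mult hit_LIMSEQ[OF assms(1)])
qed

lemma hit_prob_pos_imp_hit_pos:
  assumes "stochastic_on S K" "s \<in> S" "0 < hit_prob S K G s"
  shows "\<exists>n. 0 < hit S K G n s"
proof (rule ccontr)
  assume "\<not> ?thesis"
  then have "hit_prob S K G s \<le> 0"
    using hit_LIMSEQ[OF assms(1,2), of G] by (intro LIMSEQ_le_const2) (auto simp: not_less)
  with assms(3) show False by simp
qed

lemma hit_prob_eq_0I:
  assumes "stochastic_on S K" "s \<in> S" "\<And>n. hit S K G n s = 0"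
  shows "hit_prob S K G s = 0"
  using hit_LIMSEQ[OF assms(1,2), of G] assms(3) by (simp add: LIMSEQ_const_iff)

text \<open>By induction on \<open>n\<close>, every nonnegative supersolution of the hitting
  equations dominates the \<open>n\<close>-step approximations, hence also their limit.\<close>

lemma hit_prob_least:
  assumes st: "stochastic_on S K" and nonneg: "\<And>s. s \<in> S \<Longrightarrow> 0 \<le> w s"
    and target: "\<And>s. s \<in> S \<Longrightarrow> s \<in> G \<Longrightarrow> 1 \<le> w s"
    and step: "\<And>s. s \<in> S \<Longrightarrow> s \<notin> G \<Longrightarrow> (\<Sum>s'\<in>S. K s s' * w s') \<le> w s"
    and s: "s \<in> S"
  shows "hit_prob S K G s \<le> w s"
proof -
  have "hit S K G n s \<le> w s" for n
    using s
  proof (induction n arbitrary: s)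
    case 0
    then show ?case using nonneg target by auto
  next
    case (Suc n)
    have "(\<Sum>s'\<in>S. K s s' * hit S K G n s') \<le> (\<Sum>s'\<in>S. K s s' * w s')"
      using Suc stochastic_onD[OF st] by (intro sum_mono mult_left_mono) auto
    also have "\<dots> \<le> w s" if "s \<notin> G" using step Suc.prems that by simp
    finally show ?case using target Suc.prems by simp
  qed
  then show ?thesis
    using hit_LIMSEQ[OF st s, of G] by (intro LIMSEQ_le_const2) auto
qed

text \<open>The hypothesis on closed sets excludes the spurious solutions of the hitting equations; it is
  needed because the target need not be reachable from every state.\<close>

lemma hit_prob_greatest:
  assumes st: "stochastic_on S K"
    and target: "\<And>s. s \<in> S \<Longrightarrow> s \<in> G \<Longrightarrow> w s \<le> 1"
    and step: "\<And>s. s \<in> S \<Longrightarrow> s \<notin> G \<Longrightarrow> w s \<le> (\<Sum>s'\<in>S. K s s' * w s')"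
    and closed: "\<And>U. U \<subseteq> S \<Longrightarrow> U \<noteq> {} \<Longrightarrow> U \<inter> G = {} \<Longrightarrow>
      (\<And>s s'. s \<in> U \<Longrightarrow> s' \<in> S \<Longrightarrow> 0 < K s s' \<Longrightarrow> s' \<in> U) \<Longrightarrow> \<exists>s\<in>U. w s \<le> 0"
    and s: "s \<in> S"
  shows "w s \<le> hit_prob S K G s"
proof (rule ccontr)
  \<comment> \<open>Maximum principle for the excess \<open>d\<close> of \<open>w\<close> over the
    hitting probability: if its maximum \<open>m\<close> is positive, the set \<open>U\<close> where
    it is attained avoids \<open>G\<close> and is closed, yet a state of \<open>U\<close> with
    \<open>w u \<le> 0\<close> has nonpositive excess.\<close>
  define d where "d s = w s - hit_prob S K G s" for s
  define m where "m = Max (d ` S)"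
  define U where "U = {u \<in> S. d u = m}"
  have fin: "finite S" using stochastic_onD[OF st] by simp
  have le_m: "d u \<le> m" if "u \<in> S" for u using fin that by (simp add: m_def)
  assume "\<not> ?thesis"
  then have "0 < m" using le_m[OF s] by (simp add: d_def)
  have ne: "U \<noteq> {}"
  proof -
    have "m \<in> d ` S" unfolding m_def using fin s by (intro Max_in) auto
    then show ?thesis by (auto simp: U_def)
  qed
  have disj: "U \<inter> G = {}"
  proof -
    have "d u \<le> 0" if "u \<in> S" "u \<in> G" for u
      using target[OF that] hit_prob_target[OF st that] by (simp add: d_def)
    with \<open>0 < m\<close> show ?thesis by (force simp: U_def)
  qed
  have "\<exists>u\<in>U. w u \<le> 0"
  proof (rule closed[OF _ ne disj])
    fix u u' assume u: "u \<in> U" "u' \<in> S" "0 < K u u'"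
    then have uS: "u \<in> S" "u \<notin> G" using disj by (auto simp: U_def)
    \<comment> \<open>The \<open>K\<close>-average of \<open>d\<close> over the successors of
      \<open>u\<close> is at least \<open>m\<close>, while no value of \<open>d\<close> exceeds
      \<open>m\<close>; so every successor of positive probability has excess exactly
      \<open>m\<close>.\<close>
    have "m = w u - hit_prob S K G u" using u by (simp add: U_def d_def)
    also have "\<dots> \<le> (\<Sum>s'\<in>S. K u s' * d s')"
      using step[OF uS] hit_prob_step[OF st uS]
      by (simp add: d_def algebra_simps sum_subtractf)
    finally have "0 \<le> (\<Sum>s'\<in>S. K u s' * d s') - m * (\<Sum>s'\<in>S. K u s')"
      using stochastic_onD[OF st] uS by simp
    then have "(\<Sum>s'\<in>S. K u s' * (m - d s')) \<le> 0"
      by (simp add: algebra_simps sum_subtractf sum_distrib_left)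
    moreover have nn: "0 \<le> K u s' * (m - d s')" if "s' \<in> S" for s'
      using le_m[OF that] stochastic_onD(2)[OF st] uS that by simp
    ultimately have "(\<Sum>s'\<in>S. K u s' * (m - d s')) = 0"
      by (intro antisym sum_nonneg) auto
    then have "K u u' * (m - d u') = 0"
      using u(2) nn fin by (simp add: sum_nonneg_eq_0_iff)
    with u show "u' \<in> U" by (simp add: U_def)
  qed (auto simp: U_def)
  then obtain u where "u \<in> S" "d u = m" "w u \<le> 0" by (auto simp: U_def)
  with \<open>0 < m\<close> hit_prob_bounds[OF st, of u G] show False by (auto simp: d_def)
qed

text \<open>Renaming states does not affect hitting; this is used to copy a chain on states of the
  model into another state type.\<close>

lemma hit_reindex:
  assumes "inj_on e S" "\<And>s s'. s \<in> S \<Longrightarrow> s' \<in> S \<Longrightarrow> K' (e s) (e s') = K s s'"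
    and "\<And>s. s \<in> S \<Longrightarrow> e s \<in> G' \<longleftrightarrow> s \<in> G" and "s \<in> S"
  shows "hit (e ` S) K' G' n (e s) = hit S K G n s"
  using assms(4)
proof (induction n arbitrary: s)
  case (Suc n)
  then show ?case using assms(1-3) by (simp add: sum.reindex)
qed (use assms(3) in auto)

lemma hit_prob_reindex:
  assumes "inj_on e S" "\<And>s s'. s \<in> S \<Longrightarrow> s' \<in> S \<Longrightarrow> K' (e s) (e s') = K s s'"
    and "\<And>s. s \<in> S \<Longrightarrow> e s \<in> G' \<longleftrightarrow> s \<in> G" and "s \<in> S"
  shows "hit_prob (e ` S) K' G' (e s) = hit_prob S K G s"
  unfolding hit_prob_def by (simp add: hit_reindex[where K=K and G=G, OF assms])

lemma hit_Suc_pos: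
  assumes "stochastic_on S K" "s \<in> S" "s \<notin> G" "0 < hit S K G (Suc n) s"
  obtains s' where "s' \<in> S" "0 < K s s'" "0 < hit S K G n s'"
proof -
  from assms(3,4) have "0 < (\<Sum>s'\<in>S. K s s' * hit S K G n s')" by simp
  then obtain s' where "s' \<in> S" "0 < K s s' * hit S K G n s'"
    by (meson not_less sum_nonpos)
  moreover have "0 \<le> K s s'" "0 \<le> hit S K G n s'"
    using stochastic_onD(2)[OF assms(1,2)] hit_bounds[OF assms(1)] \<open>s' \<in> S\<close> by auto
  ultimately show thesis by (intro that[of s']) (auto simp: zero_less_mult_iff)
qed

subsection \<open>Reachability in the path measure\<close>

lemma path_measure_props:
  shows prob_space_path_measure: "prob_space (path_measure M)"
    and sets_path_measure: "sets (path_measure M) = sets (PiM UNIV (\<lambda>_. count_space UNIV))"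
    and space_path_measure: "space (path_measure M) = UNIV"
proof -
  interpret IT: Ionescu_Tulcea "mc_kernel M" "\<lambda>_. count_space UNIV"
    by (rule Ionescu_Tulcea_mc)
  show "prob_space (path_measure M)"
  proof
    have "(\<lambda>_. undefined) \<in> space (PiM {} (\<lambda>_. count_space UNIV))"
      by (simp add: space_PiM)
    \<comment> \<open>The total mass is read off the cylinder over the empty index set, which is the
      whole space.\<close>
    then have "emeasure (path_measure M) (prod_emb UNIV (\<lambda>_. count_space UNIV) {}
        (space (PiM {} (\<lambda>_. count_space UNIV)))) = 1"
      unfolding path_measure_def
      by (subst IT.lim) (simp_all add: IT.emeasure_CI[where n=0] prod_emb_id space_PiM PiM_empty)
    moreover have "space (path_measure M) = prod_emb UNIV (\<lambda>_. count_space UNIV) {}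
        (space (PiM {} (\<lambda>_. count_space UNIV)))"
      by (auto simp: path_measure_def prod_emb_def space_PiM restrict_def)
    ultimately show "emeasure (path_measure M) (space (path_measure M)) = 1" by simp
  qed
  show *: "sets (path_measure M) = sets (PiM UNIV (\<lambda>_. count_space UNIV))"
    unfolding path_measure_def by (rule IT.PF.sets_lim)
  show "space (path_measure M) = UNIV"
    using sets_eq_imp_space_eq[OF *] by (simp add: space_PiM)
qed

lemma measurable_path_event [measurable]:
  "{\<omega>. Q (\<omega> i)} \<in> sets (path_measure M)"
proof -
  have "(\<lambda>\<omega>. \<omega> i) -` {t. Q t} \<inter> space (PiM UNIV (\<lambda>_. count_space UNIV)) \<in>
      sets (PiM UNIV (\<lambda>_. count_space UNIV))"
    by (rule measurable_sets[OF measurable_component_singleton]) auto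
  then show ?thesis by (simp add: sets_path_measure space_PiM vimage_def)
qed

definition cyl :: "(nat \<Rightarrow> 't) \<Rightarrow> nat \<Rightarrow> (nat \<Rightarrow> 't) set" where
  "cyl x k = {\<omega>. \<forall>i\<le>k. \<omega> i = x i}"

lemma cyl_sets [measurable]: "cyl x k \<in> sets (path_measure M)"
proof -
  have "cyl x k = (\<Inter>i\<in>{..k}. {\<omega>. \<omega> i = x i})" by (auto simp: cyl_def)
  then show ?thesis by (auto intro!: sets.finite_INT)
qed

lemma hit_event_sets [measurable]: "{\<omega>. \<exists>i\<le>n. mc_label M (\<omega> i) = \<alpha>} \<in> sets (path_measure M')"
proof -
  have "{\<omega>. \<exists>i\<le>n. mc_label M (\<omega> i) = \<alpha>} = (\<Union>i\<in>{..n}. {\<omega>. mc_label M (\<omega> i) = \<alpha>})" by auto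
  then show ?thesis by (auto intro!: sets.finite_UN)
qed

lemma measure_cyl:
  "measure (path_measure M) (cyl x k) =
    (if x 0 = mc_init M then \<Prod>i<k. pmf (mc_trans M (x i)) (x (Suc i)) else 0)"
  unfolding cyl_def measure_def emeasure_path_measure_cylinder
  by (simp add: prod_ennreal prod_nonneg)

lemma measure_cyl_Suc:
  "measure (path_measure M) (cyl (x(Suc k := t)) (Suc k)) =
    measure (path_measure M) (cyl x k) * pmf (mc_trans M (x k)) t"
proof -
  have "(\<Prod>i<k. pmf (mc_trans M ((x(Suc k := t)) i)) ((x(Suc k := t)) (Suc i))) =
      (\<Prod>i<k. pmf (mc_trans M (x i)) (x (Suc i)))"
    by (intro prod.cong) auto
  then show ?thesis by (simp add: measure_cyl)
qed

lemma stochastic_on_mc: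
  assumes "is_mc A M"
  shows "stochastic_on (mc_states M) (\<lambda>t. pmf (mc_trans M t))"
  using assms sum_pmf_eq_1 by (auto simp: stochastic_on_def is_mc_def)

text \<open>The row of \<open>x k\<close> already sums to 1 over \<open>mc_states M\<close>, so the
  paths of the cylinder that leave \<open>mc_states M\<close> at time \<open>Suc k\<close> form a
  null set and the one-state extensions exhaust the cylinder almost surely.\<close>

lemma measure_cyl_split:
  assumes M: "is_mc A M" and x: "x k \<in> mc_states M" and E: "E \<in> sets (path_measure M)"
  shows "measure (path_measure M) (cyl x k \<inter> E) =
    (\<Sum>t\<in>mc_states M. measure (path_measure M) (cyl (x(Suc k := t)) (Suc k) \<inter> E))"
proof -
  interpret prob_space "path_measure M" by (rule prob_space_path_measure)
  let ?C = "\<lambda>t. cyl (x(Suc k := t)) (Suc k)"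
  let ?U = "\<Union>t\<in>mc_states M. ?C t"
  have fin: "finite (mc_states M)" using M by (simp add: is_mc_def)
  have U: "?U \<in> events" using fin by (intro sets.finite_UN) auto
  have sub: "?U \<subseteq> cyl x k" by (auto simp: cyl_def le_Suc_eq)
  have disj: "disjoint_family_on ?C (mc_states M)"
    by (auto simp: disjoint_family_on_def cyl_def)
  have "prob ?U = (\<Sum>t\<in>mc_states M. prob (?C t))"
    using fin disj by (intro finite_measure_finite_Union) auto
  also have "\<dots> = prob (cyl x k) * (\<Sum>t\<in>mc_states M. pmf (mc_trans M (x k)) t)"
    by (simp add: measure_cyl_Suc sum_distrib_left)
  also have "\<dots> = prob (cyl x k)"
    using stochastic_onD(3)[OF stochastic_on_mc[OF M] x] by simp
  finally have "prob (cyl x k - ?U) = 0"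
    using sub U by (subst finite_measure_Diff) auto
  moreover have "prob (cyl x k \<inter> E - ?U) \<le> prob (cyl x k - ?U)"
    using E U by (intro finite_measure_mono) auto
  ultimately have "prob (cyl x k \<inter> E - ?U) = 0"
    by (simp add: measure_le_0_iff)
  moreover have "prob (cyl x k \<inter> E) = prob (cyl x k \<inter> E - ?U) + prob (\<Union>t\<in>mc_states M. ?C t \<inter> E)"
  proof -
    have "cyl x k \<inter> E = (cyl x k \<inter> E - ?U) \<union> (\<Union>t\<in>mc_states M. ?C t \<inter> E)"
      using sub by auto
    then show ?thesis
      using E U fin by (subst finite_measure_Union[symmetric]) auto
  qed
  moreover have "prob (\<Union>t\<in>mc_states M. ?C t \<inter> E) = (\<Sum>t\<in>mc_states M. prob (?C t \<inter> E))"
    using fin disj E by (intro finite_measure_finite_Union) (auto simp: disjoint_family_on_def)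
  ultimately show ?thesis by simp
qed

text \<open>Markov property, by induction on \<open>n\<close>: the prefix is extended by one state,
  which turns \<open>k\<close> into \<open>Suc k\<close>, so \<open>x\<close> and \<open>k\<close>
  are generalised. The label is avoided only strictly before \<open>k\<close>, since
  \<open>x k\<close> may itself be the first hit.\<close>

lemma measure_cyl_hit:
  assumes M: "is_mc A M" and "x k \<in> mc_states M" "\<forall>i<k. mc_label M (x i) \<noteq> \<alpha>"
  shows "measure (path_measure M) (cyl x k \<inter> {\<omega>. \<exists>i\<le>k+n. mc_label M (\<omega> i) = \<alpha>}) =
    measure (path_measure M) (cyl x k) *
      hit (mc_states M) (\<lambda>t. pmf (mc_trans M t)) {t. mc_label M t = \<alpha>} n (x k)"
  using assms(2,3)
proof (induction n arbitrary: x k)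
  case 0
  show ?case
  proof (cases "mc_label M (x k) = \<alpha>")
    case True
    then have "cyl x k \<inter> {\<omega>. \<exists>i\<le>k+0. mc_label M (\<omega> i) = \<alpha>} = cyl x k"
      by (auto simp: cyl_def)
    with True show ?thesis by simp
  next
    case False
    then have "cyl x k \<inter> {\<omega>. \<exists>i\<le>k+0. mc_label M (\<omega> i) = \<alpha>} = {}"
      using 0 by (auto simp: cyl_def le_less)
    with False show ?thesis by simp
  qed
next
  case (Suc n)
  show ?case
  proof (cases "mc_label M (x k) = \<alpha>")
    case True
    then have "cyl x k \<inter> {\<omega>. \<exists>i\<le>k+Suc n. mc_label M (\<omega> i) = \<alpha>} = cyl x k"
      by (auto simp: cyl_def intro!: exI[of _ k])
    with True show ?thesis by simp
  next
    case False
    have "measure (path_measure M) (cyl x k \<inter> {\<omega>. \<exists>i\<le>k+Suc n. mc_label M (\<omega> i) = \<alpha>}) =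
      (\<Sum>t\<in>mc_states M. measure (path_measure M)
        (cyl (x(Suc k := t)) (Suc k) \<inter> {\<omega>. \<exists>i\<le>k+Suc n. mc_label M (\<omega> i) = \<alpha>}))"
      by (intro measure_cyl_split[where k=k and x=x, OF M Suc.prems(1)] hit_event_sets)
    also have "\<dots> = (\<Sum>t\<in>mc_states M. measure (path_measure M) (cyl (x(Suc k := t)) (Suc k)) *
        hit (mc_states M) (\<lambda>t. pmf (mc_trans M t)) {t. mc_label M t = \<alpha>} n t)"
    proof (rule sum.cong)
      fix t assume t: "t \<in> mc_states M"
      have "\<forall>i<Suc k. mc_label M ((x(Suc k := t)) i) \<noteq> \<alpha>"
        using False Suc.prems(2) by (auto simp: less_Suc_eq)
      from Suc.IH[of "x(Suc k := t)" "Suc k", OF _ this] t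
      show "measure (path_measure M)
          (cyl (x(Suc k := t)) (Suc k) \<inter> {\<omega>. \<exists>i\<le>k+Suc n. mc_label M (\<omega> i) = \<alpha>}) =
        measure (path_measure M) (cyl (x(Suc k := t)) (Suc k)) *
          hit (mc_states M) (\<lambda>t. pmf (mc_trans M t)) {t. mc_label M t = \<alpha>} n t"
        by (simp del: fun_upd_apply add: fun_upd_same)
    qed simp
    finally show ?thesis
      using False by (simp add: measure_cyl_Suc sum_distrib_left mult.assoc)
  qed
qed

text \<open>Both sides are limits of the same sequence: the events of a hit by time \<open>n\<close>
  increase to the reachability event, and their probabilities are the \<open>n\<close>-step
  approximations.\<close>

lemma reach_prob_eq_hit_prob:
  assumes M: "is_mc A M"
  shows "reach_prob M \<alpha> =
    hit_prob (mc_states M) (\<lambda>t. pmf (mc_trans M t)) {t. mc_label M t = \<alpha>} (mc_init M)"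
proof (rule LIMSEQ_unique)
  interpret prob_space "path_measure M" by (rule prob_space_path_measure)
  let ?E = "\<lambda>n. {\<omega>. \<exists>i\<le>n. mc_label M (\<omega> i) = \<alpha>}"
  let ?h = "hit (mc_states M) (\<lambda>t. pmf (mc_trans M t)) {t. mc_label M t = \<alpha>}"
  let ?C = "cyl (\<lambda>_. mc_init M) 0"
  have init: "mc_init M \<in> mc_states M" using M by (simp add: is_mc_def)
  \<comment> \<open>Almost every path starts in \<open>mc_init M\<close>; intersecting with
    \<open>?C\<close> therefore changes no probability and allows \<open>measure_cyl_hit\<close>
    with \<open>k = 0\<close>.\<close>
  have "prob ?C = 1" by (simp add: measure_cyl)
  then have C: "prob (?C \<inter> E) = prob E" if "E \<in> events" for E
    using that prob_space_axioms by (metis Int_commute cyl_sets measure_space_inter prob_space)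
  have E: "prob (?E n) = ?h n (mc_init M)" for n
    using measure_cyl_hit[OF M, where x="\<lambda>_. mc_init M" and k=0 and n=n and \<alpha>=\<alpha>] init C[of "?E n"]
    by (simp add: measure_cyl)
  have "(\<lambda>n. prob (?E n)) \<longlonglongrightarrow> prob (\<Union>n. ?E n)"
    using hit_event_sets[where M=M and M'=M and \<alpha>=\<alpha>]
    by (intro finite_Lim_measure_incseq) (auto simp: incseq_def intro: order_trans)
  moreover have "(\<Union>n. ?E n) = {\<omega> \<in> space (path_measure M). \<exists>n. mc_label M (\<omega> n) = \<alpha>}"
    by (auto simp: space_path_measure)
  ultimately show "(\<lambda>n. ?h n (mc_init M)) \<longlonglongrightarrow> reach_prob M \<alpha>"
    by (simp add: E reach_prob_def)
  show "(\<lambda>n. ?h n (mc_init M)) \<longlonglongrightarrow> hit_prob (mc_states M) (\<lambda>t. pmf (mc_trans M t))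
      {t. mc_label M t = \<alpha>} (mc_init M)"
    by (rule hit_LIMSEQ[OF stochastic_on_mc[OF M] init])
qed

subsection \<open>Chains induced by a coupling\<close>

lemma Max_attained:
  fixes x :: "'t \<Rightarrow> real"
  assumes "finite T" "T \<noteq> {}"
  obtains m where "\<And>t. t \<in> T \<Longrightarrow> x t \<le> m" "\<exists>t\<in>T. x t = m"
proof (rule that)
  show "x t \<le> Max (x ` T)" if "t \<in> T" for t using assms that by simp
  show "\<exists>t\<in>T. x t = Max (x ` T)"   proof -
    have "Max (x ` T) \<in> x ` T" using assms by (intro Max_in) auto
    then show ?thesis by auto
  qed
qed

text \<open>The second marginal of \<open>D t s\<close>, unlike the first, may depend on both arguments: it is the
  distribution of the successors of \<open>s\<close> as seen from \<open>t\<close>.\<close>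

locale coupling =
  fixes T :: "'t set" and K :: "'t \<Rightarrow> 't \<Rightarrow> real" and G :: "'t set"
    and S :: "'s set" and H :: "'s set" and R :: "('t \<times> 's) set"
    and D :: "'t \<Rightarrow> 's \<Rightarrow> 't \<Rightarrow> 's \<Rightarrow> real"
  assumes st: "stochastic_on T K" and finS: "finite S" and R_sub: "R \<subseteq> T \<times> S"
    and target_iff: "(t, s) \<in> R \<Longrightarrow> t \<in> G \<longleftrightarrow> s \<in> H"
    and D_nonneg: "(t, s) \<in> R \<Longrightarrow> t' \<in> T \<Longrightarrow> s' \<in> S \<Longrightarrow> 0 \<le> D t s t' s'"
    and D_supp: "(t, s) \<in> R \<Longrightarrow> t' \<in> T \<Longrightarrow> s' \<in> S \<Longrightarrow> 0 < D t s t' s' \<Longrightarrow> (t', s') \<in> R"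
    and D_marginal: "(t, s) \<in> R \<Longrightarrow> t' \<in> T \<Longrightarrow> (\<Sum>s'\<in>S. D t s t' s') = K t t'"
begin

text \<open>\<open>f s\<close> is the partner chosen for \<open>s\<close>, and the row of
  \<open>s\<close> is the second marginal of \<open>D (f s) s\<close>.\<close>

definition induced :: "('s \<Rightarrow> 't) \<Rightarrow> 's \<Rightarrow> 's \<Rightarrow> real" where
  "induced f s s' = (\<Sum>t'\<in>T. D (f s) s t' s')"

abbreviation value_at :: "'t \<Rightarrow> real" where
  "value_at \<equiv> hit_prob T K G"

lemma finT: "finite T"
  using stochastic_onD[OF st] by simp

lemma D_eq_0: "(t, s) \<in> R \<Longrightarrow> t' \<in> T \<Longrightarrow> s' \<in> S \<Longrightarrow> (t', s') \<notin> R \<Longrightarrow> D t s t' s' = 0"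
  using D_nonneg[of t s t' s'] D_supp[of t s t' s'] by fastforce

text \<open>\<open>D\<close> charges only related pairs, so nothing is lost by restricting the model
  to \<open>Range R\<close>, where the induced chain lives.\<close>

lemma sum_Range:
  assumes "(t, s) \<in> R" "t' \<in> T"
  shows "(\<Sum>s'\<in>S. D t s t' s' * g s') = (\<Sum>s'\<in>Range R. D t s t' s' * g s')"
  using assms R_sub finS D_eq_0 by (intro sum.mono_neutral_right) (auto, blast)

text \<open>The row of \<open>s\<close> has the total mass of \<open>D (f s) s\<close>, which its
  first marginal identifies with the row sum of \<open>K\<close> at \<open>f s\<close>.\<close>

lemma stochastic_on_induced:
  assumes f: "\<And>s. s \<in> Range R \<Longrightarrow> (f s, s) \<in> R"
  shows "stochastic_on (Range R) (induced f)"
  unfolding stochastic_on_def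
proof (intro conjI ballI)
  show "finite (Range R)" using finS R_sub by (auto intro: finite_subset[of _ S])
next
  fix s s' assume "s \<in> Range R" "s' \<in> Range R"
  then show "0 \<le> induced f s s'"
    unfolding induced_def using f R_sub by (intro sum_nonneg D_nonneg) auto
next
  fix s assume s: "s \<in> Range R"
  have "(\<Sum>s'\<in>Range R. induced f s s') = (\<Sum>t'\<in>T. \<Sum>s'\<in>Range R. D (f s) s t' s')"
    unfolding induced_def by (rule sum.swap)
  also have "\<dots> = (\<Sum>t'\<in>T. K (f s) t')"
    using sum_Range[OF f[OF s], of _ "\<lambda>_. 1"] D_marginal[OF f[OF s]] by (intro sum.cong) auto
  also have "\<dots> = 1"
    using stochastic_onD(3)[OF st] f[OF s] R_sub by auto
  finally show "(\<Sum>s'\<in>Range R. induced f s s') = 1" .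
qed

text \<open>The hitting equation of \<open>K\<close> is spread over pairs \<open>(t', s')\<close> so
  that it can be compared term by term with the equation of an induced chain in
  \<open>induced_sum\<close>.\<close>

lemma value_at_step:
  assumes "(t, s) \<in> R" "s \<notin> H"
  shows "value_at t = (\<Sum>t'\<in>T. \<Sum>s'\<in>Range R. D t s t' s' * value_at t')"
proof -
  have "value_at t = (\<Sum>t'\<in>T. K t t' * value_at t')"
    using assms target_iff R_sub by (intro hit_prob_step[OF st]) auto
  also have "\<dots> = (\<Sum>t'\<in>T. \<Sum>s'\<in>S. D t s t' s' * value_at t')"
    using D_marginal[OF assms(1)] by (simp flip: sum_distrib_right)
  finally show ?thesis using sum_Range[OF assms(1)] by simp
qed

lemma induced_sum:
  "(\<Sum>s'\<in>Range R. induced f s s' * w s') = (\<Sum>t'\<in>T. \<Sum>s'\<in>Range R. D (f s) s t' s' * w s')"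
  unfolding induced_def sum_distrib_right by (rule sum.swap)

lemma D_mult_mono:
  assumes "(t, s) \<in> R" "t' \<in> T" "s' \<in> Range R" "(t', s') \<in> R \<Longrightarrow> a \<le> b"
  shows "D t s t' s' * a \<le> D t s t' s' * b"
proof (cases "(t', s') \<in> R")
  case True
  then show ?thesis using assms D_nonneg R_sub by (intro mult_left_mono) auto
next
  case False
  then show ?thesis using assms D_eq_0[of t s t' s'] R_sub by auto
qed

text \<open>With \<open>f s\<close> a partner of minimal value, replacing \<open>value_at t'\<close>
  by \<open>value_at (f s')\<close> on a related pair can only decrease it. Hence
  \<open>value_at (f s)\<close> is a supersolution for the induced chain and
  \<open>hit_prob_least\<close> applies.\<close>

lemma induced_le:
  "\<exists>f. (\<forall>s\<in>Range R. (f s, s) \<in> R) \<and>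
    (\<forall>(t, s)\<in>R. hit_prob (Range R) (induced f) H s \<le> value_at t)"
proof -
  have "\<exists>t. (t, s) \<in> R \<and> (\<forall>t'. (t', s) \<in> R \<longrightarrow> value_at t \<le> value_at t')" if "s \<in> Range R" for s
  proof -
    have "finite {t. (t, s) \<in> R}" "{t. (t, s) \<in> R} \<noteq> {}"
      using R_sub that by (auto intro: finite_subset[OF _ finT])
    from Max_attained[OF this, of "\<lambda>t. - value_at t"] show ?thesis by auto (metis neg_le_iff_le)
  qed
  then obtain f where f: "\<And>s. s \<in> Range R \<Longrightarrow> (f s, s) \<in> R"
    and le: "\<And>s t. (t, s) \<in> R \<Longrightarrow> value_at (f s) \<le> value_at t"
    by (metis RangeI)
  note st' = stochastic_on_induced[OF f]
  have "hit_prob (Range R) (induced f) H s \<le> value_at (f s)" if "s \<in> Range R" for s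
  proof (rule hit_prob_least[where w="\<lambda>s. value_at (f s)", OF st' _ _ _ that])
    fix s assume s: "s \<in> Range R"
    then have fs: "f s \<in> T" using f R_sub by auto
    show "0 \<le> value_at (f s)" using hit_prob_bounds[OF st fs] by simp
    show "1 \<le> value_at (f s)" if "s \<in> H"
      using hit_prob_target[OF st fs] target_iff[OF f[OF s]] that by simp
    show "(\<Sum>s'\<in>Range R. induced f s s' * value_at (f s')) \<le> value_at (f s)" if "s \<notin> H"
      unfolding induced_sum value_at_step[OF f[OF s] that]
      by (intro sum_mono D_mult_mono f s le)
  qed
  with f le show ?thesis by (intro exI[of _ f]) (fastforce intro: order_trans)
qed

text \<open>Among the states \<open>t\<close> of maximal value related to \<open>s\<close> one that is closest to the target has to be
  chosen, since otherwise the induced chain may cycle within a set of states of maximal value.\<close>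

lemma induced_ge:
  "\<exists>f. (\<forall>s\<in>Range R. (f s, s) \<in> R) \<and>
    (\<forall>(t, s)\<in>R. value_at t \<le> hit_prob (Range R) (induced f) H s)"
proof -
  \<comment> \<open>The least number of steps within which the target is hit with positive
    probability. The value is arbitrary where no such number exists, and is exploited only at states
    where one does.\<close>
  define dist where "dist t = (LEAST n. 0 < hit T K G n t)" for t
  have "\<exists>t. (t, s) \<in> R \<and> (\<forall>t'. (t', s) \<in> R \<longrightarrow> value_at t' \<le> value_at t) \<and>
      (\<forall>t'. (t', s) \<in> R \<longrightarrow> value_at t' = value_at t \<longrightarrow> dist t \<le> dist t')" if "s \<in> Range R" for s
  proof -
    have "finite {t. (t, s) \<in> R}" "{t. (t, s) \<in> R} \<noteq> {}"
      using R_sub that by (auto intro: finite_subset[OF _ finT])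
    then obtain m where m: "\<And>t. (t, s) \<in> R \<Longrightarrow> value_at t \<le> m" "\<exists>t. (t, s) \<in> R \<and> value_at t = m"
      using Max_attained[of "{t. (t, s) \<in> R}" value_at] by auto
    then obtain t where "(t, s) \<in> R \<and> value_at t = m"
      "\<And>t'. (t', s) \<in> R \<and> value_at t' = m \<Longrightarrow> dist t \<le> dist t'"
      using exists_least_iff ex_has_least_nat[of "\<lambda>t. (t, s) \<in> R \<and> value_at t = m" _ dist] by metis
    with m(1) show ?thesis by metis
  qed
  then obtain f where f: "\<And>s. s \<in> Range R \<Longrightarrow> (f s, s) \<in> R"
    and ge: "\<And>s t. (t, s) \<in> R \<Longrightarrow> value_at t \<le> value_at (f s)"
    and closest: "\<And>s t. (t, s) \<in> R \<Longrightarrow> value_at t = value_at (f s) \<Longrightarrow> dist (f s) \<le> dist t"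
    by (metis RangeI)
  note st' = stochastic_on_induced[OF f]
  have fT: "f s \<in> T" if "s \<in> Range R" for s using f[OF that] R_sub by auto
  have "value_at (f s) \<le> hit_prob (Range R) (induced f) H s" if "s \<in> Range R" for s
  proof (rule hit_prob_greatest[where w="\<lambda>s. value_at (f s)", OF st' _ _ _ that])
    fix s assume s: "s \<in> Range R"
    show "value_at (f s) \<le> 1" using hit_prob_bounds[OF st fT[OF s]] by simp
    show "value_at (f s) \<le> (\<Sum>s'\<in>Range R. induced f s s' * value_at (f s'))" if "s \<notin> H"
      unfolding induced_sum value_at_step[OF f[OF s] that]
      by (intro sum_mono D_mult_mono f s ge)
  next
    fix U assume U: "U \<subseteq> Range R" "U \<noteq> {}" "U \<inter> H = {}"
      and closed: "\<And>s s'. s \<in> U \<Longrightarrow> s' \<in> Range R \<Longrightarrow> 0 < induced f s s' \<Longrightarrow> s' \<in> U"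
    have "finite U" using U(1) stochastic_onD(1)[OF st'] by (rule finite_subset)
    from Max_attained[OF this U(2), of "\<lambda>s. value_at (f s)"] obtain m where
      m: "\<And>s. s \<in> U \<Longrightarrow> value_at (f s) \<le> m" "\<exists>s\<in>U. value_at (f s) = m" by blast
    show "\<exists>s\<in>U. value_at (f s) \<le> 0"
    proof (rule ccontr)
      assume "\<not> ?thesis"
      then have "0 < m" using m(2) by force
      \<comment> \<open>Two minimisations are combined: \<open>f s\<close> is closest to the target
        among the partners of \<open>s\<close> of maximal value, and \<open>s\<close> is chosen so
        that \<open>f s\<close> is closest among the states of \<open>U\<close> with value
        \<open>m\<close>.\<close>
      obtain s where s: "s \<in> U" "value_at (f s) = m"
        and least: "\<And>s'. s' \<in> U \<Longrightarrow> value_at (f s') = m \<Longrightarrow> dist (f s) \<le> dist (f s')"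
        using m(2) ex_has_least_nat[of "\<lambda>s. s \<in> U \<and> value_at (f s) = m" _ "\<lambda>s. dist (f s)"] by metis
      have sR: "s \<in> Range R" "s \<notin> H" using s U by auto
      let ?t = "f s"
      have tR: "(?t, s) \<in> R" and tT: "?t \<in> T" using f fT sR by auto
      \<comment> \<open>The value \<open>m\<close> of \<open>?t\<close> is the
        \<open>D\<close>-average of values that are at most \<open>m\<close> wherever the weight is
        positive. Equality of the sums forces equality of the terms, so every charged pair has value
        \<open>m\<close>.\<close>
      have succ: "s' \<in> U \<and> value_at t' = m" if t': "t' \<in> T" "(t', s') \<in> R" "0 < D ?t s t' s'" for t' s'
      proof -
        have in_U: "s'' \<in> U" if "t'' \<in> T" "s'' \<in> Range R" "0 < D ?t s t'' s''" for t'' s''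
        proof (rule closed[OF s(1) that(2)])
          have "0 < (\<Sum>t\<in>T. D ?t s t s'')"
            using that finT D_nonneg[OF tR] R_sub by (intro sum_pos2[of _ t'']) auto
          then show "0 < induced f s s''" by (simp add: induced_def)
        qed
        have le: "D ?t s t'' s'' * value_at t'' \<le> D ?t s t'' s'' * m"
          if "t'' \<in> T" "s'' \<in> Range R" for t'' s''
        proof (cases "0 < D ?t s t'' s''")
          case True
          with in_U that have "s'' \<in> U" by blast
          moreover have "(t'', s'') \<in> R" using D_supp[OF tR] that True R_sub by auto
          ultimately have "value_at t'' \<le> m" using ge m(1) by (blast intro: order_trans)
          with True show ?thesis by simp
        next
          case False
          then have "D ?t s t'' s'' = 0" using D_nonneg[OF tR, of t'' s''] that R_sub by force
          then show ?thesis by simp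
        qed
        have "(\<Sum>t''\<in>T. \<Sum>s''\<in>Range R. D ?t s t'' s'' * m) = m"
          using stochastic_onD(3)[OF st' sR(1)] induced_sum[of f s "\<lambda>_. m"]
          by (simp flip: sum_distrib_right)
        then have eq: "(\<Sum>t''\<in>T. \<Sum>s''\<in>Range R. D ?t s t'' s'' * value_at t'') =
            (\<Sum>t''\<in>T. \<Sum>s''\<in>Range R. D ?t s t'' s'' * m)"
          using value_at_step[OF tR sR(2)] s(2) by simp
        have finR: "finite (Range R)" by (rule stochastic_onD(1)[OF st'])
        have "s' \<in> Range R" using t' by auto
        have "(\<Sum>s''\<in>Range R. D ?t s t' s'' * value_at t') = (\<Sum>s''\<in>Range R. D ?t s t' s'' * m)"
          using sum_mono_inv[OF eq _ t'(1) finT] le by (auto intro: sum_mono)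
        from sum_mono_inv[OF this _ \<open>s' \<in> Range R\<close> finR] le t'(1)
        have "D ?t s t' s' * value_at t' = D ?t s t' s' * m" by auto
        with t' in_U \<open>s' \<in> Range R\<close> show ?thesis by auto
      qed
      have "\<exists>n. 0 < hit T K G n ?t"
        using hit_prob_pos_imp_hit_pos[OF st tT] s(2) \<open>0 < m\<close> by simp
      then have pos: "0 < hit T K G (dist ?t) ?t"
        unfolding dist_def by (rule LeastI_ex)
      have "?t \<notin> G" using target_iff[OF tR] sR by simp
      with pos obtain n where n: "dist ?t = Suc n" by (cases "dist ?t") auto
      \<comment> \<open>A step towards the target leads to a \<open>t'\<close> that hits it within
        \<open>n\<close> steps and is coupled with some \<open>s'\<close> in \<open>U\<close>. Then
        \<open>dist ?t \<le> dist (f s') \<le> dist t' \<le> n\<close>, which contradicts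
        \<open>dist ?t = Suc n\<close>.\<close>
      with pos hit_Suc_pos[OF st tT \<open>?t \<notin> G\<close>] obtain t' where
        t': "t' \<in> T" "0 < K ?t t'" "0 < hit T K G n t'" by metis
      have "0 < (\<Sum>s'\<in>S. D ?t s t' s')" using t' D_marginal[OF tR] by simp
      then obtain s' where s': "s' \<in> S" "0 < D ?t s t' s'" by (meson not_less sum_nonpos)
      then have R': "(t', s') \<in> R" using D_supp[OF tR] t' by blast
      from succ[OF t'(1) R' s'(2)] have "s' \<in> U" "value_at t' = m" by auto
      moreover from this have "value_at (f s') = m"
        using ge[OF R'] m(1) by force
      ultimately have "dist ?t \<le> dist t'"
        using least[of s'] closest[OF R'] by simp
      moreover have "dist t' \<le> n" unfolding dist_def using t'(3) by (rule Least_le)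
      ultimately show False using n by simp
    qed
  qed
  with f ge show ?thesis by (intro exI[of _ f]) (fastforce intro: order_trans)
qed

end

subsection \<open>Chains selected from a parametric model\<close>

text \<open>Absent transitions force probability exactly 0. The value is computed from the
  representation of 0 with denominator 1.\<close>

lemma interval_at_zero: "interval_at v (0, 0) = {0}"
proof -
  have "mpoly_eval v 1 = 1"
    by (simp add: mpoly_eval_single monom_eval_def flip: single_one)
  moreover have "ratfun_defined v 0"
    unfolding ratfun_defined_def Zero_fract_def using calculation by (intro exI) auto
  moreover have "ratfun_eval v 0 = 0"
    unfolding Zero_fract_def using calculation by (simp add: ratfun_eval_Fract)
  ultimately show ?thesis by (simp add: interval_at_def)
qed

text \<open>The common form of CSP solutions and of Markov chains living on the model. Interval
  membership is demanded towards all states of the model: towards a state outside \<open>U\<close>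
  the entry is 0, and 0 has to be an allowed probability there.\<close>

definition selects_chain ::
    "('s, 'a, 'y::linorder) pimc \<Rightarrow> ('y \<Rightarrow> real) \<Rightarrow> 's set \<Rightarrow> ('s \<Rightarrow> 's \<Rightarrow> real) \<Rightarrow> bool" where
  "selects_chain P v U q \<longleftrightarrow>
    (\<forall>y\<in>pimc_params P. v y \<in> {0..1}) \<and> U \<subseteq> pimc_states P \<and> pimc_init P \<in> U \<and> stochastic_on U q \<and>
    (\<forall>s\<in>U. \<forall>s'\<in>pimc_states P.
      q s s' \<in> interval_at v (pimc_trans P s s') \<and> (q s s' \<noteq> 0 \<longrightarrow> s' \<in> U))"

lemma selects_chainD:
  assumes "selects_chain P v U q"
  shows "y \<in> pimc_params P \<Longrightarrow> v y \<in> {0..1}" "U \<subseteq> pimc_states P" "pimc_init P \<in> U" "stochastic_on U q"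
    "s \<in> U \<Longrightarrow> s' \<in> pimc_states P \<Longrightarrow> q s s' \<in> interval_at v (pimc_trans P s s')"
    "s \<in> U \<Longrightarrow> s' \<in> pimc_states P \<Longrightarrow> q s s' \<noteq> 0 \<Longrightarrow> s' \<in> U"
  using assms by (auto simp: selects_chain_def)

text \<open>The satisfaction relation yields a coupling; its selections by \<open>induced_le\<close>
  and \<open>induced_ge\<close> give the two bounds, possibly with different chains.\<close>

lemma sat_pimc_imp_chain:
  fixes P :: "('s, 'a, 'y::linorder) pimc" and M :: "('t, 'a) mc" and \<alpha> :: "'a set"
  assumes P: "is_pimc A P" and M: "is_mc A M" and sat: "sat_pimc_at_every_step M P"
  defines "H \<equiv> {s. pimc_label P s = \<alpha>}"
  shows "\<exists>v U q. selects_chain P v U q \<and> hit_prob U q H (pimc_init P) \<le> reach_prob M \<alpha>"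
    and "\<exists>v U q. selects_chain P v U q \<and> reach_prob M \<alpha> \<le> hit_prob U q H (pimc_init P)"
proof -
  define Q where "Q v R t s \<delta> \<longleftrightarrow>
    (\<forall>t'\<in>mc_states M. \<forall>s'\<in>pimc_states P. \<delta> t' s' \<in> {0..1}) \<and>
    (\<forall>t'\<in>mc_states M. pmf (mc_trans M t) t' > 0 \<longrightarrow> (\<Sum>s'\<in>pimc_states P. \<delta> t' s') = 1) \<and>
    (\<forall>s'\<in>pimc_states P.
      (\<Sum>t'\<in>mc_states M. pmf (mc_trans M t) t' * \<delta> t' s') \<in> interval_at v (pimc_trans P s s')) \<and>
    (\<forall>t'\<in>mc_states M. \<forall>s'\<in>pimc_states P. \<delta> t' s' > 0 \<longrightarrow> (t', s') \<in> R)"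
    for v R t s and \<delta> :: "'t \<Rightarrow> 's \<Rightarrow> real"
  from sat obtain v R where v: "\<forall>y\<in>pimc_params P. v y \<in> {0..1}"
    and R: "R \<subseteq> mc_states M \<times> pimc_states P" "(mc_init M, pimc_init P) \<in> R"
    and all: "\<forall>(t, s)\<in>R. mc_label M t = pimc_label P s \<and> (\<exists>\<delta>. Q v R t s \<delta>)"
    unfolding sat_pimc_at_every_step_def sat_imc_at_every_step_def pimc_at_def imc.simps Q_def by blast
  have label: "mc_label M t = pimc_label P s" if "(t, s) \<in> R" for t s
    using all that by auto
  have "\<forall>ts\<in>R. \<exists>\<delta>. Q v R (fst ts) (snd ts) \<delta>" using all by auto
  then obtain \<delta>' where "\<forall>ts\<in>R. Q v R (fst ts) (snd ts) (\<delta>' ts)" by (rule bchoice[THEN exE])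
  then have Q: "Q v R t s (\<delta>' (t, s))" if "(t, s) \<in> R" for t s using that by force
  define \<delta> where "\<delta> t s = \<delta>' (t, s)" for t s
  have bounds: "0 \<le> \<delta> t s t' s'"
    if "(t, s) \<in> R" "t' \<in> mc_states M" "s' \<in> pimc_states P" for t s t' s'
    using Q[OF that(1)] that(2,3) by (simp add: Q_def \<delta>_def)
  have sum1: "(\<Sum>s'\<in>pimc_states P. \<delta> t s t' s') = 1"
    if "(t, s) \<in> R" "t' \<in> mc_states M" "pmf (mc_trans M t) t' > 0" for t s t'
    using Q[OF that(1)] that(2,3) by (simp add: Q_def \<delta>_def)
  have ival: "(\<Sum>t'\<in>mc_states M. pmf (mc_trans M t) t' * \<delta> t s t' s') \<in> interval_at v (pimc_trans P s s')"
    if "(t, s) \<in> R" "s' \<in> pimc_states P" for t s s'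
    using Q[OF that(1)] that(2) by (simp add: Q_def \<delta>_def)
  have supp: "(t', s') \<in> R"
    if "(t, s) \<in> R" "t' \<in> mc_states M" "s' \<in> pimc_states P" "\<delta> t s t' s' > 0" for t s t' s'
    using Q[OF that(1)] that(2-) by (simp add: Q_def \<delta>_def)
  \<comment> \<open>The joint weight of \<open>(t', s')\<close> is the probability of moving to
    \<open>t'\<close> times the share of \<open>t'\<close> assigned to \<open>s'\<close>. Where the
    transition probability is 0 the shares need not sum to 1, but then both sides of the marginal
    equation vanish.\<close>
  interpret coupling "mc_states M" "\<lambda>t. pmf (mc_trans M t)" "{t. mc_label M t = \<alpha>}" "pimc_states P" H R
    "\<lambda>t s t' s'. pmf (mc_trans M t) t' * \<delta> t s t' s'"
  proof
    show "stochastic_on (mc_states M) (\<lambda>t. pmf (mc_trans M t))" by (rule stochastic_on_mc[OF M])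
    show "finite (pimc_states P)" using P by (simp add: is_pimc_def)
    show "R \<subseteq> mc_states M \<times> pimc_states P" by (rule R(1))
  next
    fix t s assume ts: "(t, s) \<in> R"
    show "t \<in> {t. mc_label M t = \<alpha>} \<longleftrightarrow> s \<in> H" using label[OF ts] by (simp add: H_def)
    fix t' assume t': "t' \<in> mc_states M"
    show "(\<Sum>s'\<in>pimc_states P. pmf (mc_trans M t) t' * \<delta> t s t' s') = pmf (mc_trans M t) t'"
      using sum1[OF ts t'] by (cases "pmf (mc_trans M t) t' = 0") (auto simp flip: sum_distrib_left)
    fix s' assume s': "s' \<in> pimc_states P"
    show "0 \<le> pmf (mc_trans M t) t' * \<delta> t s t' s'" using bounds[OF ts t' s'] by simp
    assume "0 < pmf (mc_trans M t) t' * \<delta> t s t' s'"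
    then show "(t', s') \<in> R"
      using bounds[OF ts t' s'] by (intro supp[OF ts t' s']) (auto simp: zero_less_mult_iff)
  qed
  have selects: "selects_chain P v (Range R) (induced f)" if f: "\<forall>s\<in>Range R. (f s, s) \<in> R" for f
    unfolding selects_chain_def
  proof (intro conjI ballI impI)
    show "stochastic_on (Range R) (induced f)" using f by (intro stochastic_on_induced) blast
  next
    fix s s' assume s: "s \<in> Range R" "s' \<in> pimc_states P"
    then have fs: "(f s, s) \<in> R" using f by blast
    \<comment> \<open>The entry is the very sum that the satisfaction relation places in the
      interval for the pair \<open>(f s, s)\<close>.\<close>
    show "induced f s s' \<in> interval_at v (pimc_trans P s s')"
      unfolding induced_def by (rule ival[OF fs s(2)])
    assume "induced f s s' \<noteq> 0"
    then obtain t' where "t' \<in> mc_states M" "pmf (mc_trans M (f s)) t' * \<delta> (f s) s t' s' \<noteq> 0"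
      unfolding induced_def by (meson sum.neutral)
    with D_eq_0[OF fs _ s(2)] show "s' \<in> Range R" by blast
  qed (use v R in auto)
  note reach = reach_prob_eq_hit_prob[OF M, of \<alpha>]
  from induced_le obtain f where "\<forall>s\<in>Range R. (f s, s) \<in> R"
    "\<forall>(t, s)\<in>R. hit_prob (Range R) (induced f) H s \<le> value_at t" by blast
  with R(2) selects[of f] show "\<exists>v U q. selects_chain P v U q \<and> hit_prob U q H (pimc_init P) \<le> reach_prob M \<alpha>"
    unfolding reach by blast
  from induced_ge obtain f where "\<forall>s\<in>Range R. (f s, s) \<in> R"
    "\<forall>(t, s)\<in>R. value_at t \<le> hit_prob (Range R) (induced f) H s" by blast
  with R(2) selects[of f] show "\<exists>v U q. selects_chain P v U q \<and> reach_prob M \<alpha> \<le> hit_prob U q H (pimc_init P)"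
    unfolding reach by blast
qed

section \<open>Realising a selected chain as a Markov chain\<close>

lemma pmf_with_finite_support:
  fixes f :: "'t \<Rightarrow> real"
  assumes "finite T" "\<And>t. t \<in> T \<Longrightarrow> 0 \<le> f t" "(\<Sum>t\<in>T. f t) = 1"
  shows "\<exists>p. set_pmf p \<subseteq> T \<and> (\<forall>t\<in>T. pmf p t = f t)"
proof -
  define g where "g t = (if t \<in> T then f t else 0)" for t
  have nn: "0 \<le> g t" for t using assms(2) by (simp add: g_def)
  have "(\<integral>\<^sup>+t. ennreal (g t) \<partial>count_space UNIV) = (\<Sum>t\<in>T. ennreal (g t))"
    using assms(1) by (intro nn_integral_count_space') (auto simp: g_def)
  also have "\<dots> = ennreal (\<Sum>t\<in>T. g t)" using nn by (simp add: sum_ennreal)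
  also have "(\<Sum>t\<in>T. g t) = 1" using assms(3) by (simp add: g_def)
  finally have "(\<integral>\<^sup>+t. ennreal (g t) \<partial>count_space UNIV) = 1" by simp
  from pmf_embed_pmf[OF nn this] obtain p where "\<And>t. pmf p t = g t" by blast
  then show ?thesis
    by (intro exI[of _ p]) (auto simp: set_pmf_eq g_def split: if_splits)
qed

text \<open>The finite set \<open>U\<close> is copied into the infinite type \<open>'t\<close> by an
  injection \<open>e\<close>. The graph of \<open>e\<close> is the satisfaction relation, and
  hitting probabilities survive the renaming.\<close>

lemma chain_imp_sat_pimc:
  fixes P :: "('s, 'a, 'y::linorder) pimc" and \<alpha> :: "'a set"
  assumes P: "is_pimc A P" and chain: "selects_chain P v U q"
  shows "\<exists>M :: ('t::infinite, 'a) mc. is_mc A M \<and> sat_pimc_at_every_step M P \<and>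
    reach_prob M \<alpha> = hit_prob U q {s. pimc_label P s = \<alpha>} (pimc_init P)"
proof -
  note D = selects_chainD[OF chain]
  have finS: "finite (pimc_states P)" using P by (simp add: is_pimc_def)
  have finU: "finite U" by (rule stochastic_onD(1)[OF D(4)])
  obtain e :: "'s \<Rightarrow> 't" where e: "inj_on e U" using arb_inj_on_finite_infinite[OF finU] by blast
  define d where "d = inv_into U e"
  have d [simp]: "d (e s) = s" if "s \<in> U" for s using e that by (simp add: d_def)
  have "\<exists>p. set_pmf p \<subseteq> e ` U \<and> (\<forall>t'\<in>e ` U. pmf p t' = q s (d t'))" if s: "s \<in> U" for s
    using stochastic_onD[OF D(4)] s
    by (intro pmf_with_finite_support) (auto simp: sum.reindex[OF e] cong: sum.cong)
  then obtain \<mu> where \<mu>: "\<And>s. s \<in> U \<Longrightarrow> set_pmf (\<mu> s) \<subseteq> e ` U"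
    "\<And>s s'. s \<in> U \<Longrightarrow> s' \<in> U \<Longrightarrow> pmf (\<mu> s) (e s') = q s s'"
    by (metis d image_eqI)
  define M :: "('t, 'a) mc" where "M = \<lparr>mc_states = e ` U, mc_init = e (pimc_init P),
    mc_trans = (\<lambda>t. \<mu> (d t)), mc_label = (\<lambda>t. pimc_label P (d t))\<rparr>"
  have M: "is_mc A M"
    using P \<mu>(1) D(2,3) finU by (auto simp: is_mc_def M_def is_pimc_def)
  have "sat_imc_at_every_step M (pimc_at v P)"
    unfolding sat_imc_at_every_step_def
  proof (intro exI[of _ "(\<lambda>s. (e s, s)) ` U"] conjI ballI, goal_cases)
    case (3 ts)
    then obtain s where s: "s \<in> U" "ts = (e s, s)" by auto
    \<comment> \<open>Each copy represents one state only, so its share is the Dirac distribution at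
      the original \<open>d t'\<close>.\<close>
    define \<delta> :: "'t \<Rightarrow> 's \<Rightarrow> real" where "\<delta> t' s' = (if s' = d t' then 1 else 0)" for t' s'
    have sum: "(\<Sum>t'\<in>e ` U. pmf (\<mu> s) t' * \<delta> t' s') = q s s'" if s': "s' \<in> pimc_states P" for s'
    proof -
      have "(\<Sum>t'\<in>e ` U. pmf (\<mu> s) t' * \<delta> t' s') = (\<Sum>u\<in>U. if s' = u then q s u else 0)"
        using s(1) \<mu>(2) by (auto simp: sum.reindex[OF e] \<delta>_def intro!: sum.cong)
      also have "\<dots> = q s s'" using finU D(6)[OF s(1) s'] by auto
      finally show ?thesis .
    qed
    show ?case
      using s D(2) D(5)[OF s(1)] sum finS
      by (auto simp: M_def pimc_at_def \<delta>_def[abs_def] intro!: exI[of _ \<delta>] split: if_splits)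
  qed (use D(2,3) in \<open>auto simp: M_def pimc_at_def\<close>)
  then have "sat_pimc_at_every_step M P"
    using D(1) by (auto simp: sat_pimc_at_every_step_def)
  moreover have "reach_prob M \<alpha> = hit_prob U q {s. pimc_label P s = \<alpha>} (pimc_init P)"
    unfolding reach_prob_eq_hit_prob[OF M] using D(3) \<mu>(2)
    by (auto simp: M_def intro!: hit_prob_reindex[OF e])
  ultimately show ?thesis using M by blast
qed

subsection \<open>Solutions of the CSP\<close>

text \<open>Backward breadth-first search from \<open>G\<close>: the rank is 1 plus the distance to
  \<open>G\<close>, and 0 if \<open>G\<close> cannot be reached. It supplies both counters of the
  CSP, with reversed edges for \<open>omega\<close>.\<close>

lemma rank_exists:
  fixes E :: "'s \<Rightarrow> 's \<Rightarrow> bool"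
  assumes fin: "finite S" and sub: "G \<subseteq> S"
  obtains rank :: "'s \<Rightarrow> nat" where
    "\<And>s. s \<in> S \<Longrightarrow> rank s \<le> card S"
    "\<And>s. rank s = 1 \<longleftrightarrow> s \<in> G"
    "\<And>s. s \<in> S \<Longrightarrow> 1 < rank s \<Longrightarrow> \<exists>s'\<in>S. E s s' \<and> rank s = Suc (rank s')"
    "\<And>s s'. s \<in> S \<Longrightarrow> s' \<in> S \<Longrightarrow> E s s' \<Longrightarrow> 0 < rank s' \<Longrightarrow> 0 < rank s"
proof
  \<comment> \<open>\<open>level n\<close> collects the states with an \<open>E\<close>-path to
    \<open>G\<close> of length at most \<open>n\<close>. In \<open>rank\<close> the least such
    \<open>n\<close> is shifted by one because 0 is reserved for unreachability.\<close>
  define level where "level n = rec_nat G (\<lambda>_ L. L \<union> {s \<in> S. \<exists>s'\<in>L. E s s'}) n" for n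
  have level_0: "level 0 = G" and level_Suc: "\<And>n. level (Suc n) = level n \<union> {s \<in> S. \<exists>s'\<in>level n. E s s'}"
    by (simp_all add: level_def)
  have level_sub: "level n \<subseteq> S" for n
    by (induction n) (use sub in \<open>auto simp: level_0 level_Suc\<close>)
  define rank where "rank s = (if \<exists>n. s \<in> level n then Suc (LEAST n. s \<in> level n) else 0)" for s
  have rank_le: "rank s \<le> Suc n" "0 < rank s" if "s \<in> level n" for s n
    using that Least_le[of "\<lambda>n. s \<in> level n" n] by (auto simp: rank_def)
  have rank_Suc: "s \<in> level n" if "rank s = Suc n" for s n
    using that by (auto simp: rank_def split: if_splits intro: LeastI_ex)
  show "rank s = 1 \<longleftrightarrow> s \<in> G" for s
    using rank_le[of s 0] rank_Suc[of s 0] by (auto simp: level_0)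
  show step: "\<exists>s'\<in>S. E s s' \<and> rank s = Suc (rank s')" if "s \<in> S" "1 < rank s" for s
  proof -
    from that(2) obtain n where n: "rank s = Suc (Suc n)" by (metis One_nat_def less_imp_Suc_add add_Suc)
    have "s \<notin> level n" using rank_le[of s n] n by auto
    with rank_Suc[OF n] obtain s' where s': "s' \<in> level n" "E s s'" by (auto simp: level_Suc)
    have "rank s' = Suc n"
    proof (rule antisym)
      show "rank s' \<le> Suc n" by (rule rank_le(1)[OF s'(1)])
      have "s' \<in> level (rank s' - 1)" using rank_Suc[of s' "rank s' - 1"] rank_le(2)[OF s'(1)] by simp
      with s'(2) that(1) have "s \<in> level (Suc (rank s' - 1))" by (auto simp: level_Suc)
      from rank_le(1)[OF this] n rank_le(2)[OF s'(1)] show "Suc n \<le> rank s'" by simp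
    qed
    with s' n level_sub[of n] show ?thesis by (intro bexI[of _ s']) auto
  qed
  show "0 < rank s" if "s \<in> S" "s' \<in> S" "E s s'" "0 < rank s'" for s s'
  proof -
    from that(4) obtain n where "rank s' = Suc n" by (cases "rank s'") auto
    from rank_Suc[OF this] that have "s \<in> level (Suc n)" by (auto simp: level_Suc)
    then show ?thesis by (rule rank_le(2))
  qed
  \<comment> \<open>Descending along \<open>step\<close> shows that all smaller positive ranks occur
    as well, so a rank cannot exceed the number of states.\<close>
  have "{1..n} \<subseteq> rank ` S" if "s \<in> S" "rank s = n" for s n
    using that
  proof (induction n arbitrary: s)
    case (Suc n)
    show ?case
    proof (cases "n = 0")
      case True
      with Suc.prems show ?thesis by force
    next
      case False
      with step[of s] Suc.prems obtain s' where "s' \<in> S" "rank s' = n" by auto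
      from Suc.IH[OF this] Suc.prems show ?thesis by (force simp: atLeastAtMostSuc_conv)
    qed
  qed simp
  then show "rank s \<le> card S" if "s \<in> S" for s
    using that card_mono[of "rank ` S" "{1..rank s}"] card_image_le[OF fin, of rank] fin by simp
qed

text \<open>The CSP sums over \<open>Succ P s\<close> and the chain over \<open>U\<close>; both
  agree with the sum over all states, as the extra terms vanish.\<close>

lemma sum_over_Succ:
  assumes finS: "finite (pimc_states P)" and UB: "U \<subseteq> pimc_states P"
    and on_Succ: "\<And>s'. s' \<in> Succ P s \<Longrightarrow> k s' = \<theta> s'"
    and off_Succ: "\<And>s'. s' \<in> pimc_states P \<Longrightarrow> s' \<notin> Succ P s \<Longrightarrow> k s' = 0"
    and off_U: "\<And>s'. s' \<in> pimc_states P \<Longrightarrow> s' \<notin> U \<Longrightarrow> k s' = 0"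
  shows "(\<Sum>s'\<in>Succ P s. \<theta> s' * g s') = (\<Sum>s'\<in>U. k s' * (g s' :: real))"
proof -
  have "(\<Sum>s'\<in>Succ P s. \<theta> s' * g s') = (\<Sum>s'\<in>Succ P s. k s' * g s')"
    using on_Succ by simp
  also have "\<dots> = (\<Sum>s'\<in>pimc_states P. k s' * g s')"
    using finS off_Succ by (intro sum.mono_neutral_left) (auto simp: Succ_def)
  also have "\<dots> = (\<Sum>s'\<in>U. k s' * g s')"
    using finS UB off_U by (intro sum.mono_neutral_right) auto
  finally show ?thesis .
qed

text \<open>The states with \<open>rho\<close> and the weights \<open>theta\<close> form the chain.
  \<open>pr\<close> solves its hitting equations, which bounds it below by
  \<open>hit_prob_least\<close>; the counter \<open>alph\<close> provides the closed-set condition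
  for the converse bound by \<open>hit_prob_greatest\<close>.\<close>

lemma csp_solution_imp_chain:
  fixes P :: "('s, 'a, 'y::linorder) pimc" and \<alpha> :: "'a set"
  assumes P: "is_pimc A P"
    and dom: "\<forall>x\<in>csp_vars (reach_csp P \<alpha>). \<sigma> x \<in> csp_dom (reach_csp P \<alpha>) x"
    and cons: "\<forall>c\<in>csp_constraints (reach_csp P \<alpha>). c \<sigma>"
  shows "\<exists>v U q. selects_chain P v U q \<and>
    hit_prob U q {s. pimc_label P s = \<alpha>} (pimc_init P) = pr \<sigma> (pimc_init P)"
proof -
  let ?S = "pimc_states P" and ?H = "{s. pimc_label P s = \<alpha>}"
  have finS: "finite ?S" and init: "pimc_init P \<in> ?S" using P by (auto simp: is_pimc_def)
  have struct: "\<forall>c\<in>structure_constraints P s. c \<sigma>" if "s \<in> ?S" for s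
    using cons that by (auto simp: reach_csp_def)
  have to_label: "\<forall>c\<in>to_label_constraints P \<alpha> s. c \<sigma>" if "s \<in> ?S" for s
    using cons that by (auto simp: reach_csp_def)
  have probability: "\<forall>c\<in>probability_constraints P \<alpha> s. c \<sigma>" if "s \<in> ?S" for s
    using cons that by (auto simp: reach_csp_def)
  have eta01: "eta \<sigma> y \<in> {0..1}" if "y \<in> pimc_params P" for y
    using bspec[OF dom, of "Eta_var y"] that
    by (auto simp: reach_csp_def reach_csp_vars_def eta_def)
  have theta01: "theta \<sigma> s s' \<in> {0..1}" if "s \<in> ?S" "s' \<in> Succ P s" for s s'
  proof -
    have "Theta_var s s' \<in> csp_vars (reach_csp P \<alpha>)"
      using that by (auto simp: reach_csp_def reach_csp_vars_def)
    from bspec[OF dom this] show ?thesis by (auto simp: reach_csp_def theta_def)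
  qed
  have pr01: "pr \<sigma> s \<in> {0..1}" if "s \<in> ?S" for s
    using bspec[OF dom, of "Pi_var s"] that
    by (auto simp: reach_csp_def reach_csp_vars_def pr_def)
  have alph_nonneg: "0 \<le> alph \<sigma> s" if "s \<in> ?S" for s
    using bspec[OF dom, of "Alpha_var s"] that
    by (auto simp: reach_csp_def reach_csp_vars_def alph_def)
  have rho_init: "rho \<sigma> (pimc_init P)"
    using struct[OF init] by (simp add: structure_constraints_def)
  have rho_sum: "(\<Sum>s'\<in>Succ P s. theta \<sigma> s s') = 1" if "s \<in> ?S" "rho \<sigma> s" for s
    using struct[OF that(1)] that(2) by (simp add: structure_constraints_def)
  have not_rho_sum: "(\<Sum>s'\<in>Pred P s - {s}. theta \<sigma> s' s) = 0" if "s \<in> ?S" "\<not> rho \<sigma> s" for s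
    using struct[OF that(1)] that(2) rho_init by (auto simp: structure_constraints_def)
  have bounds: "case pimc_trans P s s' of (f\<^sub>1, f\<^sub>2) \<Rightarrow>
       ratfun_defined (eta \<sigma>) f\<^sub>1 \<and> ratfun_defined (eta \<sigma>) f\<^sub>2 \<and>
       ratfun_eval (eta \<sigma>) f\<^sub>1 \<le> theta \<sigma> s s' \<and> theta \<sigma> s s' \<le> ratfun_eval (eta \<sigma>) f\<^sub>2"
    "case pimc_trans P s s' of (f\<^sub>1, f\<^sub>2) \<Rightarrow>
         0 \<le> ratfun_eval (eta \<sigma>) f\<^sub>1 \<and> ratfun_eval (eta \<sigma>) f\<^sub>2 \<le> 1"
    if "s \<in> ?S" "s' \<in> Succ P s" "rho \<sigma> s" for s s'
    using struct[OF that(1)] that(2,3) by (auto simp: structure_constraints_def)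
  have alph_target: "alph \<sigma> s = 1" if "s \<in> ?S" "s \<in> ?H" for s
    using to_label[OF that(1)] that(2) by (simp add: to_label_constraints_def)
  have alph_ne_1: "alph \<sigma> s \<noteq> 1" if "s \<in> ?S" "s \<notin> ?H" for s
    using to_label[OF that(1)] that(2) by (simp add: to_label_constraints_def)
  have lam_iff: "lam \<sigma> s \<longleftrightarrow> rho \<sigma> s \<and> alph \<sigma> s \<noteq> 0" if "s \<in> ?S" for s
    using to_label[OF that(1)] by (simp add: to_label_constraints_def)
  have alph_step: "\<exists>s'\<in>Succ P s - {s}. alph \<sigma> s = alph \<sigma> s' + 1 \<and> theta \<sigma> s s' > 0"
    if "s \<in> ?S" "s \<notin> ?H" "alph \<sigma> s > 1" for s
    using to_label[OF that(1)] that(2,3) by (simp add: to_label_constraints_def)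
  have alph_0: "alph \<sigma> s' = 0 \<or> theta \<sigma> s s' = 0"
    if "s \<in> ?S" "s \<notin> ?H" "alph \<sigma> s = 0" "s' \<in> Succ P s - {s}" for s s'
    using to_label[OF that(1)] that(2-) by (simp add: to_label_constraints_def)
  have pr_0: "pr \<sigma> s = 0" if "s \<in> ?S" "\<not> lam \<sigma> s" for s
    using probability[OF that(1)] that(2) by (simp add: probability_constraints_def)
  have pr_1: "pr \<sigma> s = 1" if "s \<in> ?S" "s \<in> ?H" "lam \<sigma> s" for s
    using probability[OF that(1)] that(2-) by (simp add: probability_constraints_def)
  have pr_step: "pr \<sigma> s = (\<Sum>s'\<in>Succ P s. theta \<sigma> s s' * pr \<sigma> s')"
    if "s \<in> ?S" "s \<notin> ?H" "lam \<sigma> s" for s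
    using probability[OF that(1)] that(2-) by (simp add: probability_constraints_def)

  define U where "U = {s \<in> ?S. rho \<sigma> s}"
  \<comment> \<open>A variable \<open>theta\<close> exists only for pairs in \<open>Succ\<close>;
    elsewhere its value under \<open>\<sigma>\<close> is meaningless and is replaced by 0.\<close>
  define q where "q s s' = (if s' \<in> Succ P s then theta \<sigma> s s' else 0)" for s s'
  have US: "s \<in> ?S" "rho \<sigma> s" if "s \<in> U" for s using that by (auto simp: U_def)
  have q_nonneg: "0 \<le> q s s'" if "s \<in> ?S" for s s'
    using theta01[OF that] by (auto simp: q_def)
  \<comment> \<open>An unselected state has incoming sum 0 with nonnegative terms, so every term is
    0. The omitted self-loop is harmless since \<open>s\<close> is selected and \<open>s'\<close> is
    not.\<close>
  have q_supp: "s' \<in> U" if s: "s \<in> U" and s': "s' \<in> ?S" and q: "q s s' \<noteq> 0" for s s'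
  proof (rule ccontr)
    assume "s' \<notin> U"
    with s' have "\<not> rho \<sigma> s'" by (simp add: U_def)
    with US[OF s] have "s \<noteq> s'" by auto
    have "s \<in> Pred P s'" using q US[OF s] by (auto simp: q_def Succ_def Pred_def split: if_splits)
    moreover have "finite (Pred P s' - {s'})" using finS by (simp add: Pred_def)
    moreover have "0 \<le> theta \<sigma> s'' s'" if "s'' \<in> Pred P s' - {s'}" for s''
      using theta01[of s'' s'] that s' by (auto simp: Pred_def Succ_def)
    ultimately have "theta \<sigma> s s' = 0"
      using not_rho_sum[OF s' \<open>\<not> rho \<sigma> s'\<close>] \<open>s \<noteq> s'\<close> sum_nonneg_eq_0_iff[of "Pred P s' - {s'}"]
      by (metis Diff_iff empty_iff insert_iff)
    with q show False by (simp add: q_def split: if_splits)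
  qed
  have sum_eq: "(\<Sum>s'\<in>Succ P s. theta \<sigma> s s' * g s') = (\<Sum>s'\<in>U. q s s' * g s')" if "s \<in> U" for s g
  proof -
    have off_U: "q s s' = 0" if "s' \<in> ?S" "s' \<notin> U" for s'
      using q_supp[OF \<open>s \<in> U\<close> that(1)] that(2) by blast
    show ?thesis
      by (rule sum_over_Succ[OF finS _ _ _ off_U]) (auto simp: q_def U_def)
  qed
  have st: "stochastic_on U q"
    unfolding stochastic_on_def
    using finS q_nonneg rho_sum sum_eq[of _ "\<lambda>_. 1"] by (auto simp: U_def)
  have chain: "selects_chain P (eta \<sigma>) U q"
    unfolding selects_chain_def
  proof (intro conjI ballI impI)
    show "pimc_init P \<in> U" using init rho_init by (simp add: U_def)
    fix s s' assume s: "s \<in> U" "s' \<in> ?S"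
    show "q s s' \<in> interval_at (eta \<sigma>) (pimc_trans P s s')"
    proof (cases "s' \<in> Succ P s")
      case True
      with bounds[OF US(1)[OF s(1)] True US(2)[OF s(1)]] show ?thesis
        by (auto simp: interval_at_def q_def)
    next
      case False
      then have "pimc_trans P s s' = (0, 0)" using s(2) by (simp add: Succ_def)
      with False show ?thesis by (simp add: q_def interval_at_zero)
    qed
  qed (use eta01 st q_supp in \<open>auto simp: U_def\<close>)
  have initU: "pimc_init P \<in> U" using init rho_init by (simp add: U_def)
  have "hit_prob U q ?H (pimc_init P) \<le> pr \<sigma> (pimc_init P)"
  proof (rule hit_prob_least[OF st _ _ _ initU])
    fix s assume s: "s \<in> U"
    note sS = US[OF s]
    show "0 \<le> pr \<sigma> s" using pr01[OF sS(1)] by simp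
    show "1 \<le> pr \<sigma> s" if "s \<in> ?H"
      using pr_1[OF sS(1) that] alph_target[OF sS(1) that] lam_iff[OF sS(1)] sS(2) by simp
    show "(\<Sum>s'\<in>U. q s s' * pr \<sigma> s') \<le> pr \<sigma> s" if nt: "s \<notin> ?H"
    proof (cases "lam \<sigma> s")
      case True
      then show ?thesis using pr_step[OF sS(1) nt] sum_eq[OF s] by simp
    next
      case False
      \<comment> \<open>A successor other than \<open>s\<close> with positive weight again has
        counter 0, hence \<open>pr\<close> is 0 there, as it is at \<open>s\<close> itself; the
        whole sum vanishes.\<close>
      then have "alph \<sigma> s = 0" using lam_iff[OF sS(1)] sS(2) by simp
      have "q s s' * pr \<sigma> s' = 0" if "s' \<in> U" for s'
      proof (cases "s' \<in> Succ P s - {s}")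
        case True
        from alph_0[OF sS(1) nt \<open>alph \<sigma> s = 0\<close> True] True show ?thesis
          using lam_iff[OF US(1)[OF that]] pr_0[OF US(1)[OF that]] by (auto simp: q_def)
      next
        case False
        then show ?thesis using pr_0[OF sS(1) \<open>\<not> lam \<sigma> s\<close>] by (auto simp: q_def)
      qed
      then have "(\<Sum>s'\<in>U. q s s' * pr \<sigma> s') = 0" by (rule sum.neutral[OF ballI])
      then show ?thesis using pr01[OF sS(1)] by simp
    qed
  qed
  moreover have "pr \<sigma> (pimc_init P) \<le> hit_prob U q ?H (pimc_init P)"
  proof (rule hit_prob_greatest[OF st _ _ _ initU])
    fix s assume s: "s \<in> U"
    note sS = US[OF s]
    show "pr \<sigma> s \<le> 1" using pr01[OF sS(1)] by simp
    show "pr \<sigma> s \<le> (\<Sum>s'\<in>U. q s s' * pr \<sigma> s')" if nt: "s \<notin> ?H"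
    proof (cases "lam \<sigma> s")
      case True
      then show ?thesis using pr_step[OF sS(1) nt] sum_eq[OF s] by simp
    next
      case False
      have "0 \<le> (\<Sum>s'\<in>U. q s s' * pr \<sigma> s')"
        using q_nonneg[OF sS(1)] pr01 US(1) by (intro sum_nonneg mult_nonneg_nonneg) auto
      with pr_0[OF sS(1) False] show ?thesis by simp
    qed
  next
    fix W assume W: "W \<subseteq> U" "W \<noteq> {}" "W \<inter> ?H = {}"
      and closed: "\<And>s s'. s \<in> W \<Longrightarrow> s' \<in> U \<Longrightarrow> 0 < q s s' \<Longrightarrow> s' \<in> W"
    show "\<exists>s\<in>W. pr \<sigma> s \<le> 0"
    proof (rule ccontr)
      assume pos: "\<not> ?thesis"
      \<comment> \<open>A state of \<open>W\<close> with least counter: positivity of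
        \<open>pr\<close> makes the counter exceed 1, and the successor with counter one less stays
        in the closed set \<open>W\<close>.\<close>
      from W(2) obtain s where s: "s \<in> W"
        and least: "\<And>s'. s' \<in> W \<Longrightarrow> nat (alph \<sigma> s) \<le> nat (alph \<sigma> s')"
        using ex_has_least_nat[of "\<lambda>s. s \<in> W" _ "\<lambda>s. nat (alph \<sigma> s)"] by blast
      have sU: "s \<in> U" and nt: "s \<notin> ?H" using s W by auto
      note sS = US[OF sU]
      have "lam \<sigma> s" using pr_0[OF sS(1)] pos s by force
      then have "1 < alph \<sigma> s"
        using lam_iff[OF sS(1)] alph_ne_1[OF sS(1) nt] alph_nonneg[OF sS(1)] by simp
      from alph_step[OF sS(1) nt this] obtain s' where
        s': "s' \<in> Succ P s" "alph \<sigma> s = alph \<sigma> s' + 1" "0 < theta \<sigma> s s'" by blast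
      then have q: "0 < q s s'" and s'S: "s' \<in> ?S" by (auto simp: q_def Succ_def)
      then have "s' \<in> W" using closed[OF s _ q] q_supp[OF sU s'S] by simp
      from least[OF this] s'(2) \<open>1 < alph \<sigma> s\<close> show False by simp
    qed
  qed
  ultimately show ?thesis using chain by (intro exI) (auto intro: antisym)
qed

text \<open>\<open>U\<close> may contain states that are unreachable from the initial state, whereas
  the CSP ties \<open>rho\<close> to a nonzero \<open>omega\<close>. The solution therefore keeps
  only the reachable part of the chain.\<close>

lemma chain_imp_csp_solution:
  fixes P :: "('s, 'a, 'y::linorder) pimc" and \<alpha> :: "'a set"
  assumes P: "is_pimc A P" and chain: "selects_chain P v U q"
  shows "\<exists>\<sigma>. (\<forall>x\<in>csp_vars (reach_csp P \<alpha>). \<sigma> x \<in> csp_dom (reach_csp P \<alpha>) x) \<and>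
    (\<forall>c\<in>csp_constraints (reach_csp P \<alpha>). c \<sigma>) \<and>
    pr \<sigma> (pimc_init P) = hit_prob U q {s. pimc_label P s = \<alpha>} (pimc_init P)"
proof -
  let ?S = "pimc_states P" and ?H = "{s. pimc_label P s = \<alpha>}" and ?s0 = "pimc_init P"
  note D = selects_chainD[OF chain]
  note st = D(4)
  have finS: "finite ?S" and init: "?s0 \<in> ?S" using P by (auto simp: is_pimc_def)
  have q_nonneg: "0 \<le> q s s'" if "s \<in> U" "s' \<in> ?S" for s s'
    using stochastic_onD(2)[OF st that(1)] D(6)[OF that] by (cases "s' \<in> U") force+

  \<comment> \<open>The edge relation is reversed: its second argument is the source of the
    transition, so ranks measure the distance from the initial state.\<close>
  obtain \<omega> :: "'s \<Rightarrow> nat" where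
    \<omega>_le: "\<And>s. s \<in> ?S \<Longrightarrow> \<omega> s \<le> card ?S" and
    \<omega>_1: "\<And>s. \<omega> s = 1 \<longleftrightarrow> s \<in> {?s0}" and
    \<omega>_step: "\<And>s. s \<in> ?S \<Longrightarrow> 1 < \<omega> s \<Longrightarrow>
      \<exists>s'\<in>?S. (s' \<in> U \<and> s \<in> U \<and> 0 < q s' s) \<and> \<omega> s = Suc (\<omega> s')" and
    \<omega>_pos: "\<And>s s'. s \<in> ?S \<Longrightarrow> s' \<in> ?S \<Longrightarrow> s' \<in> U \<and> s \<in> U \<and> 0 < q s' s \<Longrightarrow> 0 < \<omega> s' \<Longrightarrow> 0 < \<omega> s"
    using rank_exists[OF finS, of "{?s0}" "\<lambda>s s'. s' \<in> U \<and> s \<in> U \<and> 0 < q s' s"] init by auto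
  define \<rho> where "\<rho> s \<longleftrightarrow> \<omega> s \<noteq> 0" for s
  define \<theta> where "\<theta> s s' = (if \<rho> s then q s s' else 0)" for s s'
  have \<rho>_U: "s \<in> U" if "s \<in> ?S" "\<rho> s" for s
    using \<omega>_step[OF that(1)] \<omega>_1[of s] that(2) D(3) by (cases "\<omega> s = 1") (auto simp: \<rho>_def)
  have \<rho>_init: "\<rho> ?s0" using \<omega>_1[of ?s0] by (simp add: \<rho>_def)
  have \<theta>_nonneg: "0 \<le> \<theta> s s'" if "s \<in> ?S" "s' \<in> ?S" for s s'
    using q_nonneg \<rho>_U that by (simp add: \<theta>_def)
  have \<theta>_pos: "\<rho> s \<and> \<rho> s'" if "s \<in> ?S" "s' \<in> ?S" "\<theta> s s' \<noteq> 0" for s s'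
  proof -
    have s: "\<rho> s" "0 < q s s'" using that \<theta>_nonneg[OF that(1,2)] by (auto simp: \<theta>_def split: if_splits)
    then have "s \<in> U" "s' \<in> U" using \<rho>_U that D(6)[of s s'] by auto
    with \<omega>_pos[of s' s] s that show ?thesis by (simp add: \<rho>_def)
  qed
  have \<theta>_Succ: "\<theta> s s' = 0" if "s \<in> ?S" "s' \<in> ?S" "s' \<notin> Succ P s" for s s'
  proof (cases "\<rho> s")
    case True
    have "pimc_trans P s s' = (0, 0)" using that by (simp add: Succ_def)
    with D(5)[OF \<rho>_U[OF that(1) True] that(2)] show ?thesis by (simp add: interval_at_zero \<theta>_def)
  qed (simp add: \<theta>_def)
  have sum_eq: "(\<Sum>s'\<in>Succ P s. \<theta> s s' * g s') = (\<Sum>s'\<in>U. \<theta> s s' * g s')" if "s \<in> ?S" for s and g :: "'s \<Rightarrow> real"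
    using \<theta>_Succ[OF that] \<theta>_pos[OF that] \<rho>_U by (intro sum_over_Succ finS D(2)) blast+
  have \<theta>_sum: "(\<Sum>s'\<in>Succ P s. \<theta> s s') = (if \<rho> s then 1 else 0)" if "s \<in> ?S" for s
    using sum_eq[OF that, of "\<lambda>_. 1"] stochastic_onD(3)[OF st, of s] \<rho>_U[OF that] by (simp add: \<theta>_def)
  have \<theta>_le_1: "\<theta> s s' \<le> 1" if "s \<in> ?S" "s' \<in> Succ P s" for s s'
  proof -
    have "\<theta> s s' \<le> (\<Sum>s'\<in>Succ P s. \<theta> s s')"
      using finS \<theta>_nonneg[OF that(1)] that(2) by (intro member_le_sum) (auto simp: Succ_def)
    with \<theta>_sum[OF that(1)] show ?thesis by (simp split: if_splits)
  qed

  obtain a :: "'s \<Rightarrow> nat" where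
    a_le: "\<And>s. s \<in> ?S \<Longrightarrow> a s \<le> card ?S" and
    a_1: "\<And>s. a s = 1 \<longleftrightarrow> s \<in> ?H \<inter> ?S" and
    a_step: "\<And>s. s \<in> ?S \<Longrightarrow> 1 < a s \<Longrightarrow> \<exists>s'\<in>?S. 0 < \<theta> s s' \<and> a s = Suc (a s')" and
    a_pos: "\<And>s s'. s \<in> ?S \<Longrightarrow> s' \<in> ?S \<Longrightarrow> 0 < \<theta> s s' \<Longrightarrow> 0 < a s' \<Longrightarrow> 0 < a s"
    using rank_exists[OF finS, of "?H \<inter> ?S" "\<lambda>s s'. 0 < \<theta> s s'"] by blast
  define h where "h = hit_prob U q ?H"
  \<comment> \<open>Along reachable states \<open>\<theta>\<close> agrees with \<open>q\<close>, and
    rank 0 is inherited by every successor of positive probability, so the target is never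
    met.\<close>
  have hit_0: "hit U q ?H n s = 0" if "s \<in> ?S" "\<rho> s" "a s = 0" for n s
    using that
  proof (induction n arbitrary: s)
    case (Suc n)
    have "q s s' * hit U q ?H n s' = 0" if "s' \<in> U" for s'
    proof (cases "\<theta> s s' = 0")
      case True
      then show ?thesis using Suc.prems by (simp add: \<theta>_def)
    next
      case False
      have s': "s' \<in> ?S" using that D(2) by auto
      have "\<rho> s'" using \<theta>_pos[OF Suc.prems(1) s' False] by simp
      moreover have "a s' = 0"
        using a_pos[OF Suc.prems(1) s'] False \<theta>_nonneg[OF Suc.prems(1) s'] Suc.prems(3) by auto
      ultimately show ?thesis using Suc.IH[OF s'] by simp
    qed
    then have "(\<Sum>s'\<in>U. q s s' * hit U q ?H n s') = 0" by (rule sum.neutral[OF ballI])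
    then show ?case using Suc.prems a_1[of s] by simp
  next
    case (0 s)
    then show ?case using a_1[of s] by simp
  qed
  \<comment> \<open>The hitting probabilities of the whole chain can be kept, because
    \<open>\<theta>\<close> never leads from a reachable state to an unreachable one.\<close>
  define \<pi> where "\<pi> s = (if \<rho> s then h s else 0)" for s
  have \<pi>01: "\<pi> s \<in> {0..1}" if "s \<in> ?S" for s
    using hit_prob_bounds[OF st \<rho>_U[OF that], of ?H] by (simp add: \<pi>_def h_def)
  have \<pi>_0: "\<pi> s = 0" if "s \<in> ?S" "\<not> (\<rho> s \<and> a s \<noteq> 0)" for s
    using hit_prob_eq_0I[OF st \<rho>_U[OF that(1)] hit_0[OF that(1)]] that(2) by (auto simp: \<pi>_def h_def)
  have \<pi>_1: "\<pi> s = 1" if "s \<in> ?S" "\<rho> s" "s \<in> ?H" for s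
    using hit_prob_target[OF st \<rho>_U[OF that(1,2)] that(3)] that(2) by (simp add: \<pi>_def h_def)
  have \<pi>_step: "\<pi> s = (\<Sum>s'\<in>Succ P s. \<theta> s s' * \<pi> s')" if "s \<in> ?S" "\<rho> s" "s \<notin> ?H" for s
  proof -
    have "h s = (\<Sum>s'\<in>U. q s s' * h s')"
      unfolding h_def by (rule hit_prob_step[OF st \<rho>_U[OF that(1,2)] that(3)])
    also have "\<dots> = (\<Sum>s'\<in>U. \<theta> s s' * \<pi> s')"
    proof (rule sum.cong)
      fix s' assume "s' \<in> U"
      with D(2) have "s' \<in> ?S" by auto
      from \<theta>_pos[OF that(1) this] that(2) show "q s s' * h s' = \<theta> s s' * \<pi> s'"
        by (auto simp: \<theta>_def \<pi>_def)
    qed simp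
    finally show ?thesis using sum_eq[OF that(1)] that(2) by (simp add: \<pi>_def)
  qed

  define \<sigma> :: "('s, 'y) assignment" where "\<sigma> x = (case x of
      Eta_var y \<Rightarrow> Real_val (v y) | Theta_var s s' \<Rightarrow> Real_val (\<theta> s s') | Rho_var s \<Rightarrow> Bool_val (\<rho> s)
    | Lambda_var s \<Rightarrow> Bool_val (\<rho> s \<and> a s \<noteq> 0) | Omega_var s \<Rightarrow> Int_val (int (\<omega> s))
    | Alpha_var s \<Rightarrow> Int_val (int (a s)) | Pi_var s \<Rightarrow> Real_val (\<pi> s))" for x
  have \<sigma>: "eta \<sigma> = v" "theta \<sigma> = \<theta>" "rho \<sigma> = \<rho>" "lam \<sigma> s \<longleftrightarrow> \<rho> s \<and> a s \<noteq> 0" "omega \<sigma> s = int (\<omega> s)"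
    "alph \<sigma> s = int (a s)" "pr \<sigma> = \<pi>" for s
    by (auto simp: fun_eq_iff eta_def theta_def rho_def lam_def omega_def alph_def pr_def \<sigma>_def)
  have "\<forall>x\<in>csp_vars (reach_csp P \<alpha>). \<sigma> x \<in> csp_dom (reach_csp P \<alpha>) x"
    using D(1) \<theta>_nonneg \<theta>_le_1 \<omega>_le a_le \<pi>01
    by (auto simp: reach_csp_def reach_csp_vars_def \<sigma>_def Succ_def intro!: image_eqI[of _ Int_val])
  moreover have "\<forall>c\<in>csp_constraints (reach_csp P \<alpha>). c \<sigma>"
  proof -
    \<comment> \<open>The counters of \<open>s\<close> and \<open>s'\<close> differ by one, so the
      predecessor is never \<open>s\<close> itself; the same holds for
      \<open>outgoing\<close>.\<close>
    have incoming: "\<exists>s'\<in>Pred P s - {s}. int (\<omega> s) = int (\<omega> s') + 1 \<and> 0 < \<theta> s' s"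
      if "s \<in> ?S" "1 < \<omega> s" for s
    proof -
      from \<omega>_step[OF that] obtain s' where s': "s' \<in> ?S" "0 < q s' s" "\<omega> s = Suc (\<omega> s')" by blast
      then have "0 < \<theta> s' s" using that by (simp add: \<theta>_def \<rho>_def)
      moreover from this have "s' \<in> Pred P s"
        using \<theta>_Succ[OF s'(1) that(1)] s'(1) that(1) by (auto simp: Pred_def Succ_def)
      ultimately show ?thesis using s' by (intro bexI[of _ s']) auto
    qed
    have outgoing: "\<exists>s'\<in>Succ P s - {s}. int (a s) = int (a s') + 1 \<and> 0 < \<theta> s s'"
      if "s \<in> ?S" "1 < a s" for s
    proof -
      from a_step[OF that] obtain s' where s': "s' \<in> ?S" "0 < \<theta> s s'" "a s = Suc (a s')" by blast
      moreover from this have "s' \<in> Succ P s" using \<theta>_Succ[OF that(1) s'(1)] by auto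
      ultimately show ?thesis by (intro bexI[of _ s']) auto
    qed
    have Pred_S: "s' \<in> ?S" if "s' \<in> Pred P s" for s s' using that by (simp add: Pred_def)
    have Succ_S: "s' \<in> ?S" if "s' \<in> Succ P s" for s s' using that by (simp add: Succ_def)
    have \<omega>_iff: "\<omega> s = 0 \<longleftrightarrow> (\<forall>s'\<in>Pred P s - {s}. \<omega> s' = 0 \<or> \<theta> s' s = 0)" if "s \<in> ?S" "s \<noteq> ?s0" for s
    proof
      assume "\<omega> s = 0"
      then show "\<forall>s'\<in>Pred P s - {s}. \<omega> s' = 0 \<or> \<theta> s' s = 0"
        using \<theta>_pos[OF Pred_S that(1)] by (auto simp: \<rho>_def)
    next
      assume *: "\<forall>s'\<in>Pred P s - {s}. \<omega> s' = 0 \<or> \<theta> s' s = 0"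
      have "\<not> 1 < \<omega> s"
      proof
        assume "1 < \<omega> s"
        from incoming[OF that(1) this] obtain s' where
          "s' \<in> Pred P s - {s}" "0 < \<theta> s' s" by blast
        moreover from this have "\<omega> s' \<noteq> 0" by (auto simp: \<theta>_def \<rho>_def split: if_splits)
        ultimately show False using * by force
      qed
      with \<omega>_1[of s] that(2) show "\<omega> s = 0" by (cases "\<omega> s = 1") auto
    qed
    have a_iff: "a s = 0 \<longleftrightarrow> (\<forall>s'\<in>Succ P s - {s}. a s' = 0 \<or> \<theta> s s' = 0)" if "s \<in> ?S" "s \<notin> ?H" for s
    proof
      assume "a s = 0"
      then show "\<forall>s'\<in>Succ P s - {s}. a s' = 0 \<or> \<theta> s s' = 0"
        using a_pos[OF that(1) Succ_S] \<theta>_nonneg[OF that(1) Succ_S] by fastforce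
    next
      assume *: "\<forall>s'\<in>Succ P s - {s}. a s' = 0 \<or> \<theta> s s' = 0"
      have "\<not> 1 < a s"
      proof
        assume "1 < a s"
        from outgoing[OF that(1) this] obtain s' where
          s': "s' \<in> Succ P s - {s}" "0 < \<theta> s s'" "int (a s) = int (a s') + 1" by blast
        with * \<open>1 < a s\<close> show False by force
      qed
      with a_1[of s] that show "a s = 0" by (cases "a s = 1") auto
    qed
    \<comment> \<open>This reduces to \<open>\<omega>_iff\<close>, since
      \<open>\<theta> s' s\<close> is 0 by construction whenever \<open>\<omega> s'\<close> is
      0.\<close>
    have no_incoming: "\<not> \<rho> s \<longleftrightarrow> (\<Sum>s'\<in>Pred P s - {s}. \<theta> s' s) = 0" if "s \<in> ?S" "s \<noteq> ?s0" for s
    proof -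
      have "(\<Sum>s'\<in>Pred P s - {s}. \<theta> s' s) = 0 \<longleftrightarrow> (\<forall>s'\<in>Pred P s - {s}. \<theta> s' s = 0)"
        using finS \<theta>_nonneg[OF Pred_S that(1)] by (intro sum_nonneg_eq_0_iff) (auto simp: Pred_def)
      also have "\<dots> \<longleftrightarrow> (\<forall>s'\<in>Pred P s - {s}. \<omega> s' = 0 \<or> \<theta> s' s = 0)"
        by (auto simp: \<theta>_def \<rho>_def)
      also have "\<dots> \<longleftrightarrow> \<not> \<rho> s" using \<omega>_iff[OF that] by (simp add: \<rho>_def)
      finally show ?thesis by simp
    qed
    have interval: "case pimc_trans P s s' of (f\<^sub>1, f\<^sub>2) \<Rightarrow>
         ratfun_defined v f\<^sub>1 \<and> ratfun_defined v f\<^sub>2 \<and>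
         ratfun_eval v f\<^sub>1 \<le> \<theta> s s' \<and> \<theta> s s' \<le> ratfun_eval v f\<^sub>2"
      "case pimc_trans P s s' of (f\<^sub>1, f\<^sub>2) \<Rightarrow> 0 \<le> ratfun_eval v f\<^sub>1 \<and> ratfun_eval v f\<^sub>2 \<le> 1"
      if "s \<in> ?S" "s' \<in> Succ P s" "\<rho> s" for s s'
      using D(5)[OF \<rho>_U[OF that(1,3)] Succ_S[OF that(2)]] that(3)
      by (auto simp: \<theta>_def interval_at_def split: if_splits)
    have c1: "\<forall>c\<in>structure_constraints P s. c \<sigma>" if "s \<in> ?S" for s
      using \<theta>_sum[OF that] no_incoming[OF that] \<rho>_init interval[OF that]
      by (simp add: structure_constraints_def \<sigma> ball_Un)
    have c2: "\<forall>c\<in>from_init_constraints P s. c \<sigma>" if "s \<in> ?S" for s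
      using \<omega>_iff[OF that] incoming[OF that] \<omega>_1[of s]
      by (cases "s = ?s0") (simp_all add: from_init_constraints_def \<sigma> \<rho>_def)
    have c3: "\<forall>c\<in>to_label_constraints P \<alpha> s. c \<sigma>" if "s \<in> ?S" for s
      using that a_iff[OF that] outgoing[OF that] a_1[of s]
      by (auto simp: to_label_constraints_def \<sigma>)
    have c4: "\<forall>c\<in>probability_constraints P \<alpha> s. c \<sigma>" if "s \<in> ?S" for s
      using \<pi>_0[OF that] \<pi>_1[OF that] \<pi>_step[OF that]
      by (auto simp: probability_constraints_def \<sigma>)
    have "\<forall>s\<in>?S. (\<forall>c\<in>structure_constraints P s. c \<sigma>) \<and>
        (\<forall>c\<in>from_init_constraints P s. c \<sigma>) \<and> (\<forall>c\<in>to_label_constraints P \<alpha> s. c \<sigma>) \<and>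
        (\<forall>c\<in>probability_constraints P \<alpha> s. c \<sigma>)"
      by (intro ballI conjI) (erule (1) bspec[OF c1] bspec[OF c2] bspec[OF c3] bspec[OF c4])+
    then show ?thesis by (simp add: reach_csp_def ball_Un)
  qed
  moreover have "pr \<sigma> ?s0 = hit_prob U q ?H ?s0"
    using \<rho>_init by (simp add: \<sigma> \<pi>_def h_def)
  ultimately show ?thesis by blast
qed

section \<open>Threshold queries\<close>

text \<open>The predicate \<open>C\<close> is arbitrary because both translations preserve the
  probability exactly.\<close>

lemma csp_satisfiable_iff_chain:
  assumes "is_pimc A P"
  shows "csp_satisfiable (csp_add (reach_csp P \<alpha>) {\<lambda>\<sigma>. C (pr \<sigma> (pimc_init P))}) \<longleftrightarrow>
    (\<exists>v U q. selects_chain P v U q \<and> C (hit_prob U q {s. pimc_label P s = \<alpha>} (pimc_init P)))"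
    (is "?L \<longleftrightarrow> ?R")
proof
  assume ?L
  then obtain \<sigma> where "\<forall>x\<in>csp_vars (reach_csp P \<alpha>). \<sigma> x \<in> csp_dom (reach_csp P \<alpha>) x"
    "\<forall>c\<in>csp_constraints (reach_csp P \<alpha>). c \<sigma>" "C (pr \<sigma> (pimc_init P))"
    by (auto simp: csp_satisfiable_def csp_add_def)
  then show ?R using csp_solution_imp_chain[OF assms, of \<alpha> \<sigma>] by metis
next
  assume ?R
  then obtain v U q where *: "selects_chain P v U q"
    "C (hit_prob U q {s. pimc_label P s = \<alpha>} (pimc_init P))" by blast
  from chain_imp_csp_solution[OF assms *(1), of \<alpha>] *(2) show ?L
    by (auto simp: csp_satisfiable_def csp_add_def)
qed

text \<open>Only the passage from a Markov chain to a selected chain may change the probability.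
  Upper thresholds survive a decrease and lower thresholds an increase, so the matching half of
  \<open>sat_pimc_imp_chain\<close> suffices.\<close>

lemma csp_satisfiable_iff_mc:
  fixes P :: "('s, 'a, 'y::linorder) pimc" and cmp :: "real \<Rightarrow> real \<Rightarrow> bool"
  assumes P: "is_pimc A P" and cmp: "cmp \<in> {(\<le>), (<), (\<ge>), (>)}"
  shows "csp_satisfiable (csp_add (reach_csp P \<alpha>) {\<lambda>\<sigma>. cmp (pr \<sigma> (pimc_init P)) p}) \<longleftrightarrow>
       (\<exists>M :: ('t::infinite, 'a) mc.
          is_mc A M \<and> sat_pimc_at_every_step M P \<and> cmp (reach_prob M \<alpha>) p)" (is "?L \<longleftrightarrow> ?R")
proof -
  let ?h = "\<lambda>U q. hit_prob U q {s. pimc_label P s = \<alpha>} (pimc_init P)"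
  have "(\<exists>v U q. selects_chain P v U q \<and> cmp (?h U q) p) \<longleftrightarrow> ?R"
  proof
    assume "\<exists>v U q. selects_chain P v U q \<and> cmp (?h U q) p"
    then obtain v U q where *: "selects_chain P v U q" "cmp (?h U q) p" by blast
    from chain_imp_sat_pimc[OF P *(1), of \<alpha>] *(2) show ?R by metis
  next
    assume ?R
    then obtain M :: "('t, 'a) mc" where M: "is_mc A M" "sat_pimc_at_every_step M P"
      "cmp (reach_prob M \<alpha>) p" by blast
    from cmp consider "cmp \<in> {(\<le>), (<)}" | "cmp \<in> {(\<ge>), (>)}" by blast
    then show "\<exists>v U q. selects_chain P v U q \<and> cmp (?h U q) p"
    proof cases
      case 1
      with sat_pimc_imp_chain(1)[OF P M(1,2), of \<alpha>] M(3) show ?thesis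
        by (auto intro: order_trans le_less_trans)
    next
      case 2
      with sat_pimc_imp_chain(2)[OF P M(1,2), of \<alpha>] M(3) show ?thesis
        by (auto intro: order_trans less_le_trans)
    qed
  qed
  with csp_satisfiable_iff_chain[OF P, of \<alpha> "\<lambda>r. cmp r p"] show ?thesis by simp
qed

theorem theorem2:
  fixes A :: "'a set"
    and P :: "('s, 'a, 'y::linorder) pimc"
    and \<alpha> :: "'a set"
    and p :: real
    and cmp :: "real \<Rightarrow> real \<Rightarrow> bool"
  assumes "is_pimc A P"
    and "\<alpha> \<subseteq> A"
    and "p \<in> {0..1}"
    and "cmp \<in> {(\<le>), (<), (\<ge>), (>)}"
  shows
    "(csp_satisfiable (csp_add (reach_csp P \<alpha>) {\<lambda>\<sigma>. cmp (pr \<sigma> (pimc_init P)) p}) \<longleftrightarrow>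
       (\<exists>M :: ('t::infinite, 'a) mc.
          is_mc A M \<and> sat_pimc_at_every_step M P \<and> cmp (reach_prob M \<alpha>) p))
     \<and>
     (\<not> csp_satisfiable (csp_add (reach_csp P \<alpha>) {\<lambda>\<sigma>. \<not> cmp (pr \<sigma> (pimc_init P)) p}) \<longleftrightarrow>
       (\<forall>M :: ('t::infinite, 'a) mc.
          is_mc A M \<longrightarrow> sat_pimc_at_every_step M P \<longrightarrow> cmp (reach_prob M \<alpha>) p))"
proof -
  \<comment> \<open>The four comparisons are closed under negation because the reals are linearly
    ordered, so the equivalence applies to the negated comparison too.\<close>
  have "(\<lambda>x y. \<not> cmp x y) \<in> {(\<le>), (<), (\<ge>), (>)}"
    using assms(4) by (auto simp: fun_eq_iff not_le not_less)
  from csp_satisfiable_iff_mc[OF assms(1) this] csp_satisfiable_iff_mc[OF assms(1,4)]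
  show ?thesis by blast
qed

end
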